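(* Let $d\in[1,+\infty]$ and let $(\varphi_{s,t})_{0\le s\le t<+\infty}$ be an evolution family of order $d$ of the unit disc $\mathbb{D}$ with Berkson-Porta data $(p,\tau)$. Suppose that $\tau(t)\equiv\tau\in\overline{\mathbb{D}}$ is constant. Then there exists a unique locally absolutely continuous function $\lambda:[0,+\infty)\to\mathbb{C}$ with $\lambda'\in L^d_{loc}([0,+\infty),\mathbb{C})$, $\lambda(0)=0$ and $\mathrm{Re}\,\lambda(t)\ge\mathrm{Re}\,\lambda(s)\ge0$ for all $0\le s\le t<+\infty$, such that for all $0\le s\le t$ $$\varphi_{s,t}'(\tau)=\exp(\lambda(s)-\lambda(t)).$$ Moreover, if $\tau\in\mathbb{D}$, then $$\lambda(t)=(1-|\tau|^2)\int_0^t p(\tau,\xi)\,d\xi\quad\text{for all }t\ge0,$$ while, if $\tau\in\partial\mathbb{D}$, then $$\lambda(t)=\int_0^t\left(\angle\lim_{z\to\tau}\frac{2|\tau-z|^2\,\mathrm{Re}\,p(z,\xi)}{1-|z|^2}\right)d\xi\quad\text{for all }t\ge0.$$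
   Context: $\mathbb{D}=\{\zeta\in\mathbb{C}:|\zeta|<1\}$. Evolution family: for $d\in[1,+\infty]$, a family $(\varphi_{s,t})_{0\le s\le t<+\infty}$ of holomorphic self-maps of $\mathbb{D}$ is an evolution family of order $d$ if (1) $\varphi_{s,s}=\mathrm{id}_{\mathbb{D}}$ for all $s\ge 0$; (2) $\varphi_{s,t}=\varphi_{u,t}\circ\varphi_{s,u}$ for all $0\le s\le u\le t<+\infty$; (3) for all $z\in\mathbb{D}$ and all $T>0$ there is a non-negative $k_{z,T}\in L^d([0,T],\mathbb{R})$ with $|\varphi_{s,u}(z)-\varphi_{s,t}(z)|\le\int_u^t k_{z,T}(\xi)\,d\xi$ for all $0\le s\le u\le t\le T$. Herglotz function: a Herglotz function of order $d$ is a function $p:\mathbb{D}\times[0,+\infty)\to\mathbb{C}$ such that $t\mapsto p(z,t)$ belongs to $L^d_{loc}([0,+\infty),\mathbb{C})$ for every $z\in\mathbb{D}$, $z\mapsto p(z,t)$ is holomorphic for every $t\ge0$, and $\mathrm{Re}\,p(z,t)\ge0$ for all $z\in\mathbb{D}$, $t\ge0$. Berkson-Porta data: a pair $(p,\tau)$, with $p$ a Herglotz function of order $d$ and $\tau:[0,+\infty)\to\overline{\mathbb{D}}$ measurable, is the Berkson-Porta data of the evolution family $(\varphi_{s,t})$ of order $d$ if, with $G(z,t)=(z-\tau(t))(\overline{\tau(t)}z-1)p(z,t)$, for all $z\in\mathbb{D}$ and $s\ge0$ one has $\frac{\partial\varphi_{s,t}(z)}{\partial t}=G(\varphi_{s,t}(z),t)$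 for a.e. $t\in[s,+\infty)$. (Every evolution family of order $d$ has such data, essentially unique.) $\angle\lim$ denotes the angular (non-tangential) limit. If $\tau\in\mathbb{D}$, $\varphi_{s,t}'(\tau)$ is the usual derivative; if $\tau\in\partial\mathbb{D}$, it is the angular derivative $f'(\tau)=\angle\lim_{z\to\tau}\frac{f(z)-\tau}{z-\tau}$ at the boundary fixed point $\tau$ (i.e. $\angle\lim_{z\to\tau}f(z)=\tau$), with $f=\varphi_{s,t}$. *)

theory Defs
  imports "HOL-Analysis.Analysis"
begin

abbreviation unit_disc :: "complex set" where
  "unit_disc \<equiv> ball 0 1"

(* Functions on [0,+\<infinity>), or on pairs 0 \<le> s \<le> t, are total functions on real whose values
   elsewhere are irrelevant: every notion below only inspects the intended domain. *)

definition L_on :: "ennreal \<Rightarrow> real set \<Rightarrow> (real \<Rightarrow> 'a::euclidean_space) \<Rightarrow> bool" where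
  "L_on d S f \<longleftrightarrow>
     set_borel_measurable lebesgue S f \<and>
     (if d = \<infinity> then \<exists>C. AE t in lebesgue. t \<in> S \<longrightarrow> norm (f t) \<le> C
      else set_integrable lebesgue S (\<lambda>t. norm (f t) powr enn2real d))"

definition L_loc :: "ennreal \<Rightarrow> (real \<Rightarrow> 'a::euclidean_space) \<Rightarrow> bool" where
  "L_loc d f \<longleftrightarrow> (\<forall>T>0. L_on d {0..T} f)"

definition evolution_family ::
  "ennreal \<Rightarrow> (real \<Rightarrow> real \<Rightarrow> complex \<Rightarrow> complex) \<Rightarrow> bool" where
  "evolution_family d \<phi> \<longleftrightarrow>
     (\<forall>s t. 0 \<le> s \<longrightarrow> s \<le> t \<longrightarrow> \<phi> s t holomorphic_on unit_disc \<and> \<phi> s t \<in> unit_disc \<rightarrow> unit_disc) \<and>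
     (\<forall>s\<ge>0. \<forall>z\<in>unit_disc. \<phi> s s z = z) \<and>
     (\<forall>s u t. 0 \<le> s \<longrightarrow> s \<le> u \<longrightarrow> u \<le> t \<longrightarrow> (\<forall>z\<in>unit_disc. \<phi> s t z = \<phi> u t (\<phi> s u z))) \<and>
     (\<forall>z\<in>unit_disc. \<forall>T>0. \<exists>k :: real \<Rightarrow> real.
        (\<forall>\<xi>\<in>{0..T}. 0 \<le> k \<xi>) \<and> L_on d {0..T} k \<and>
        (\<forall>s u t. 0 \<le> s \<longrightarrow> s \<le> u \<longrightarrow> u \<le> t \<longrightarrow> t \<le> T \<longrightarrow>
           norm (\<phi> s u z - \<phi> s t z) \<le> (LINT \<xi>:{u..t}|lebesgue. k \<xi>)))"

definition herglotz_function :: "ennreal \<Rightarrow> (complex \<Rightarrow> real \<Rightarrow> complex) \<Rightarrow> bool" where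
  "herglotz_function d p \<longleftrightarrow>
     (\<forall>z\<in>unit_disc. L_loc d (\<lambda>t. p z t)) \<and>
     (\<forall>t\<ge>0. (\<lambda>z. p z t) holomorphic_on unit_disc) \<and>
     (\<forall>z\<in>unit_disc. \<forall>t\<ge>0. 0 \<le> Re (p z t))"

definition berkson_porta_field ::
  "(complex \<Rightarrow> real \<Rightarrow> complex) \<Rightarrow> (real \<Rightarrow> complex) \<Rightarrow> complex \<Rightarrow> real \<Rightarrow> complex" where
  "berkson_porta_field p \<tau> z t = (z - \<tau> t) * (cnj (\<tau> t) * z - 1) * p z t"

definition berkson_porta_data ::
  "ennreal \<Rightarrow> (real \<Rightarrow> real \<Rightarrow> complex \<Rightarrow> complex) \<Rightarrow>
   (complex \<Rightarrow> real \<Rightarrow> complex) \<Rightarrow> (real \<Rightarrow> complex) \<Rightarrow> bool" where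
  "berkson_porta_data d \<phi> p \<tau> \<longleftrightarrow>
     herglotz_function d p \<and>
     set_borel_measurable lebesgue {0..} \<tau> \<and> (\<forall>t\<ge>0. \<tau> t \<in> cball 0 1) \<and>
     (\<forall>z\<in>unit_disc. \<forall>s\<ge>0. AE t in lebesgue. s \<le> t \<longrightarrow>
        ((\<lambda>r. \<phi> s r z) has_vector_derivative berkson_porta_field p \<tau> (\<phi> s t z) t)
          (at t within {s..}))"

definition stolz_region :: "complex \<Rightarrow> real \<Rightarrow> complex set" where
  "stolz_region \<sigma> M = {z \<in> unit_disc. norm (z - \<sigma>) < M * (1 - norm z)}"

(* Convergence along this supremum of filters is convergence in every Stolz region, i.e. for a
   boundary point \<sigma> of the disc, (f \<longlongrightarrow> l) (at_angular \<sigma>) says that f has angular limit l at \<sigma>. *)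
definition at_angular :: "complex \<Rightarrow> complex filter" where
  "at_angular \<sigma> = (SUP M\<in>{1<..}. at \<sigma> within stolz_region \<sigma> M)"

definition has_angular_derivative ::
  "(complex \<Rightarrow> complex) \<Rightarrow> complex \<Rightarrow> complex \<Rightarrow> bool" where
  "has_angular_derivative f D \<sigma> \<longleftrightarrow>
     (f \<longlongrightarrow> \<sigma>) (at_angular \<sigma>) \<and> ((\<lambda>z. (f z - \<sigma>) / (z - \<sigma>)) \<longlongrightarrow> D) (at_angular \<sigma>)"

definition has_derivative_at_fixed_point ::
  "(complex \<Rightarrow> complex) \<Rightarrow> complex \<Rightarrow> complex \<Rightarrow> bool" where
  "has_derivative_at_fixed_point f D \<sigma> \<longleftrightarrow>
     (if \<sigma> \<in> unit_disc then (f has_field_derivative D) (at \<sigma>) else has_angular_derivative f D \<sigma>)"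

definition absolutely_continuous_on :: "real set \<Rightarrow> (real \<Rightarrow> 'a::real_normed_vector) \<Rightarrow> bool" where
  "absolutely_continuous_on S f \<longleftrightarrow>
     (\<forall>\<epsilon>>0. \<exists>\<delta>>0. \<forall>I. finite I \<longrightarrow>
        (\<forall>(a,b)\<in>I. a \<le> b \<and> {a..b} \<subseteq> S) \<longrightarrow>
        pairwise (\<lambda>(a,b) (a',b'). disjnt {a<..<b} {a'<..<b'}) I \<longrightarrow>
        (\<Sum>(a,b)\<in>I. b - a) < \<delta> \<longrightarrow>
        (\<Sum>(a,b)\<in>I. norm (f b - f a)) < \<epsilon>)"

definition locally_absolutely_continuous :: "(real \<Rightarrow> 'a::real_normed_vector) \<Rightarrow> bool" where
  "locally_absolutely_continuous f \<longleftrightarrow> (\<forall>T>0. absolutely_continuous_on {0..T} f)"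

(* The derivative of a locally absolutely continuous function exists only almost everywhere,
   so its membership in L^d_loc is expressed through a representative g. *)
definition derivative_L_loc :: "ennreal \<Rightarrow> (real \<Rightarrow> 'a::euclidean_space) \<Rightarrow> bool" where
  "derivative_L_loc d f \<longleftrightarrow>
     (\<exists>g. L_loc d g \<and>
        (AE t in lebesgue. 0 \<le> t \<longrightarrow> (f has_vector_derivative g t) (at t within {0..})))"

definition spectral_function ::
  "ennreal \<Rightarrow> (real \<Rightarrow> real \<Rightarrow> complex \<Rightarrow> complex) \<Rightarrow> complex \<Rightarrow> (real \<Rightarrow> complex) \<Rightarrow> bool" where
  "spectral_function d \<phi> \<sigma> l \<longleftrightarrow>
     locally_absolutely_continuous l \<and> derivative_L_loc d l \<and> l 0 = 0 \<and>
     (\<forall>s t. 0 \<le> s \<longrightarrow> s \<le> t \<longrightarrow> 0 \<le> Re (l s) \<and> Re (l s) \<le> Re (l t)) \<and>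
     (\<forall>s t. 0 \<le> s \<longrightarrow> s \<le> t \<longrightarrow>
        has_derivative_at_fixed_point (\<phi> s t) (exp (l s - l t)) \<sigma>)"

end

theory Submission
  imports Defs "HOL-Complex_Analysis.Complex_Analysis"
begin

text \<open>
  Let \<open>\<sigma>\<close> be the constant value of \<open>\<tau>\<close>. In a coordinate adapted to \<open>\<sigma>\<close>, every trajectory
  \<open>w(t) = \<phi> s t z\<close> solves a scalar linear equation \<open>X' = \<alpha> X\<close> whose coefficient \<open>\<alpha>\<close> depends on
  the trajectory, so \<open>X t / X s\<close> is the exponential of the integral of \<open>\<alpha>\<close>
  (\<open>linear_ode_solution\<close>). When the starting point \<open>z\<close> approaches \<open>\<sigma>\<close>, the coefficients converge
  for each time and are dominated by a multiple of \<open>norm (p 0 t)\<close>; dominated convergence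
  (\<open>linear_ode_limit\<close>) gives the derivative of \<open>\<phi> s t\<close> at \<open>\<sigma>\<close> as an exponential of an integral,
  and \<open>\<lambda>\<close> is the corresponding primitive.

  If \<open>\<sigma>\<close> lies in the disc, take \<open>X = w - \<sigma>\<close> with \<open>\<alpha> = (cnj \<sigma> * w - 1) * p w\<close>. The same argument
  in the Moebius coordinate centred at \<open>\<sigma>\<close>, where the coefficient has nonpositive real part, shows
  that trajectories starting near \<open>\<sigma>\<close> stay near \<open>\<sigma>\<close> (\<open>trajectory_attracted\<close>), and the Harnack
  inequality supplies the majorant. The limit coefficient is \<open>- (1 - (norm \<sigma>)\<^sup>2) * p \<sigma>\<close>.

  If \<open>\<sigma>\<close> lies on the circle, take the half-plane coordinate \<open>X = (\<sigma> + w) / (\<sigma> - w)\<close>, for which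
  \<open>X' = 2 * p w\<close>, that is \<open>\<alpha> = 2 * p w / X\<close>. The limit of \<open>\<alpha>\<close> as \<open>X\<close> tends to infinity within a
  sector is twice the slope given by the Julia--Wolff lemma (\<open>angular_slope_asymptotic\<close>), which
  is also the angular limit in the formula for \<open>\<lambda>\<close> (\<open>angular_slope_limit\<close>). What has to be proved
  is that a trajectory starting in a sector remains in a sector with a constant that does not
  depend on the starting point. This follows from two facts: \<open>Re X\<close> is nondecreasing in time, since
  \<open>Re p\<close> is nonnegative (\<open>half_plane_trajectory_Re_mono\<close>); and \<open>X\<close> is at most a constant times its
  initial value, by the Harnack inequality applied to the initial-value map itself
  (\<open>half_plane_trajectory_growth\<close>). Inverting the ratio of half-plane coordinates yields the angular
  derivative.

  Uniqueness of \<open>\<lambda>\<close> holds because two candidates differ by a continuous function with values in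
  \<open>2 \<pi> \<i> \<int>\<close> that vanishes at \<open>0\<close> (\<open>spectral_function_unique\<close>).

  The analytic background is the fundamental theorem of calculus and the uniqueness of solutions of
  linear equations when the derivative exists only almost everywhere. Both are derived for functions
  whose increments are bounded by integrals (\<open>dominated_increments\<close>), since that is how the
  regularity in time of an evolution family is expressed.
\<close>

section \<open>Functions whose increments are bounded by integrals\<close>

(* content is the length of an interval throughout. *)
hide_const (open) Polynomial.content

text \<open>
  A form of absolute continuity on \<open>{a..b}\<close> that the definition of an evolution family provides
  directly and that passes to products and Lipschitz images by elementary estimates.
\<close>
definition dominated_increments :: "real \<Rightarrow> real \<Rightarrow> (real \<Rightarrow> 'a::real_normed_vector) \<Rightarrow> bool" where
  "dominated_increments a b f \<longleftrightarrow>
     (\<exists>k::real \<Rightarrow> real. k integrable_on {a..b} \<and>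
        (\<forall>u v. a \<le> u \<longrightarrow> u \<le> v \<longrightarrow> v \<le> b \<longrightarrow> norm (f v - f u) \<le> integral {u..v} k))"

text \<open>
  The fundamental theorem of calculus with a negligible exceptional set \<open>N\<close>. In a fine Riemann
  sum the intervals with tags outside \<open>N\<close> are handled by the derivative. For the others, replace
  \<open>k\<close> by \<open>0\<close> on \<open>N\<close>: the Henstock lemma then says that the integrals of \<open>k\<close> over these intervals
  add up to an arbitrarily small number, and they dominate the increments of \<open>f\<close>. The
  integrability of \<open>g\<close> is part of the conclusion.
\<close>
lemma dominated_increments_has_integral:
  fixes f :: "real \<Rightarrow> 'a::banach"
  assumes "a \<le> b" and dom: "dominated_increments a b f" and N: "negligible N"
    and der: "\<And>x. \<lbrakk>x \<in> {a..b}; x \<notin> N\<rbrakk> \<Longrightarrow> (f has_vector_derivative g x) (at x within {a..b})"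
  shows "(g has_integral (f b - f a)) {a..b}"
proof -
  obtain k :: "real \<Rightarrow> real" where k: "k integrable_on {a..b}"
    and inc: "\<And>u v. \<lbrakk>a \<le> u; u \<le> v; v \<le> b\<rbrakk> \<Longrightarrow> norm (f v - f u) \<le> integral {u..v} k"
    using dom unfolding dominated_increments_def by blast
  \<comment> \<open>Changing \<open>k\<close> and \<open>g\<close> on the null set \<open>N\<close> affects neither integral.\<close>
  define k0 where "k0 = (\<lambda>x. if x \<in> N then 0 else k x)"
  define g0 where "g0 = (\<lambda>x. if x \<in> N then 0 else g x)"
  have k0: "k0 integrable_on cbox a b"
    using integrable_spike[OF k N, of k0] by (auto simp: k0_def)
  have k0_eq: "integral {u..v} k0 = integral {u..v} k" for u v
    by (rule integral_spike[OF N]) (auto simp: k0_def)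
  have "(g0 has_integral (f b - f a)) {a..b}"
    unfolding has_integral_real
  proof safe
    fix e :: real assume e: "e > 0"
    define e' where "e' = e / (2 * (b - a + 1))"
    have e': "e' > 0" using e \<open>a \<le> b\<close> by (simp add: e'_def)
    have "\<forall>x. \<exists>d>0. x \<in> {a..b} - N \<longrightarrow>
         (\<forall>y\<in>{a..b}. norm (y-x) < d \<longrightarrow> norm (f y - f x - (y-x) *\<^sub>R g x) \<le> e' * norm (y-x))"
    proof
      fix x
      show "\<exists>d>0. x \<in> {a..b} - N \<longrightarrow>
         (\<forall>y\<in>{a..b}. norm (y-x) < d \<longrightarrow> norm (f y - f x - (y-x) *\<^sub>R g x) \<le> e' * norm (y-x))"
      proof (cases "x \<in> {a..b} - N")
        case True
        then have "(f has_derivative (\<lambda>h. h *\<^sub>R g x)) (at x within {a..b})"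
          using der unfolding has_vector_derivative_def by auto
        with e' show ?thesis unfolding has_derivative_within_alt by auto
      qed (auto intro: exI[of _ 1])
    qed
    then obtain d where d: "\<And>x. 0 < d x"
                 "\<And>x y. \<lbrakk>x \<in> {a..b}; x \<notin> N; y \<in> {a..b}; norm (y-x) < d x\<rbrakk>
                        \<Longrightarrow> norm (f y - f x - (y-x) *\<^sub>R g x) \<le> e' * norm (y-x)"
      by (metis Diff_iff)
    obtain \<gamma> where \<gamma>: "gauge \<gamma>" "\<And>p. \<lbrakk>p tagged_partial_division_of (cbox a b); \<gamma> fine p\<rbrakk> \<Longrightarrow>
             sum (\<lambda>(x,k). norm(content k *\<^sub>R k0 x - integral k k0)) p < e/2"
      by (rule Henstock_lemma[OF k0, of "e/2"]) (use e in auto)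
    show "\<exists>\<gamma>. gauge \<gamma> \<and> (\<forall>\<D>. \<D> tagged_division_of {a..b} \<and> \<gamma> fine \<D> \<longrightarrow>
            norm ((\<Sum>(x,k)\<in>\<D>. content k *\<^sub>R g0 x) - (f b - f a)) < e)"
    proof (intro exI[of _ "\<lambda>x. \<gamma> x \<inter> ball x (d x)"] conjI allI impI)
      show "gauge (\<lambda>x. \<gamma> x \<inter> ball x (d x))"
        using \<gamma>(1) d(1) by (intro gauge_Int gauge_ball_dependent) auto
    next
      fix p assume "p tagged_division_of {a..b} \<and> (\<lambda>x. \<gamma> x \<inter> ball x (d x)) fine p"
      then have ptag: "p tagged_division_of {a..b}" and fine\<gamma>: "\<gamma> fine p"
        and fined: "(\<lambda>x. ball x (d x)) fine p"
        by (auto simp: fine_Int)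
      have ba: "b - a = (\<Sum>(x,K)\<in>p. Sup K - Inf K)" "f b - f a = (\<Sum>(x,K)\<in>p. f(Sup K) - f(Inf K))"
        using additive_tagged_division_1[where f= "\<lambda>x. x"] additive_tagged_division_1[where f= f]
            \<open>a \<le> b\<close> ptag by auto
      define h where "h = (\<lambda>(x,K). norm (content K *\<^sub>R k0 x - integral K k0))"
      have *: "norm (case z of (x,K) \<Rightarrow> content K *\<^sub>R g0 x - (f (Sup K) - f (Inf K)))
          \<le> e' * (case z of (x,K) \<Rightarrow> Sup K - Inf K) + h z" if "z \<in> p" for z
      proof -
        obtain x K where z: "z = (x, K)" by (cases z)
        obtain u v where K: "K = {u..v}" and xK: "x \<in> {u..v}" and kab: "{u..v} \<subseteq> {a..b}"
          using ptag \<open>z \<in> p\<close> unfolding z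
          by (metis box_real(2) tagged_division_ofD(2-4))
        have uv: "u \<le> v" "a \<le> u" "v \<le> b" "x \<in> {a..b}" "u \<in> {a..b}" "v \<in> {a..b}"
          using xK kab by auto
        have h0: "h z \<ge> 0" by (auto simp: h_def z)
        have S: "Sup K = v" "Inf K = u" using uv by (auto simp: K)
        show ?thesis
        proof (cases "x \<in> N")
          case True
          \<comment> \<open>A tag in \<open>N\<close> sees the value \<open>0\<close> of \<open>k0\<close>, so the Henstock lemma controls
            the whole integral of \<open>k\<close> over its interval, hence the increment of \<open>f\<close>.\<close>
          have "norm (f v - f u) \<le> integral {u..v} k0"
            using inc uv k0_eq by simp
          also have "\<dots> \<le> h z" using True by (simp add: h_def z K k0_def)
          finally show ?thesis using True e' uv by (simp add: z g0_def S norm_minus_commute add_increasing)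
        next
          case False
          have ball: "norm (y - x) < d x" if "y \<in> K" for y
            using fined \<open>z \<in> p\<close> that unfolding z fine_def by (fastforce simp: dist_real_def)
          have "norm ((v - u) *\<^sub>R g x - (f v - f u)) = norm (f u - f x - (u - x) *\<^sub>R g x - (f v - f x - (v - x) *\<^sub>R g x))"
            by (auto simp: algebra_simps)
          also have "\<dots> \<le> norm (f u - f x - (u - x) *\<^sub>R g x) + norm (f v - f x - (v - x) *\<^sub>R g x)"
            by (rule norm_triangle_ineq4)
          also have "\<dots> \<le> e' * norm (u - x) + e' * norm (v - x)"
            using uv ball False K by (intro add_mono d) auto
          also have "\<dots> = e' * (v - u)" using xK by (auto simp: algebra_simps)
          finally show ?thesis using False uv h0 by (simp add: z g0_def S K)
        qed
      qed
      have "norm ((\<Sum>(x,k)\<in>p. content k *\<^sub>R g0 x) - (f b - f a))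
          = norm (\<Sum>z\<in>p. (case z of (x,K) \<Rightarrow> content K *\<^sub>R g0 x - (f (Sup K) - f (Inf K))))"
        by (simp add: ba split_def sum_subtractf)
      also have "\<dots> \<le> (\<Sum>z\<in>p. e' * (case z of (x,K) \<Rightarrow> Sup K - Inf K) + h z)"
        by (rule sum_norm_le) (rule *)
      also have "\<dots> = e' * (b - a) + sum h p"
        by (simp add: sum.distrib sum_distrib_left ba)
      also have "sum h p < e/2"
        unfolding h_def using \<gamma>(2)[of p] ptag fine\<gamma> by (simp add: tagged_division_of_def)
      also have "e' * (b - a) \<le> e/2"
        using e \<open>a \<le> b\<close> by (simp add: e'_def field_simps)
      finally show "norm ((\<Sum>(x,k)\<in>p. content k *\<^sub>R g0 x) - (f b - f a)) < e" by simp
    qed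
  qed
  then show ?thesis
    by (rule has_integral_spike[OF N, rotated]) (auto simp: g0_def)
qed

lemma dominated_increments_continuous:
  assumes "dominated_increments a b f"
  shows "continuous_on {a..b} f"
proof -
  obtain k :: "real \<Rightarrow> real" where k: "k integrable_on {a..b}"
    and inc: "\<And>u v. \<lbrakk>a \<le> u; u \<le> v; v \<le> b\<rbrakk> \<Longrightarrow> norm (f v - f u) \<le> integral {u..v} k"
    using assms unfolding dominated_increments_def by blast
  define F where "F = (\<lambda>x. integral {a..x} k)"
  have F: "integral {u..v} k = F v - F u" if "a \<le> u" "u \<le> v" "v \<le> b" for u v
    using Henstock_Kurzweil_Integration.integral_combine[of a u v k] that
      integrable_on_subinterval[OF k, of a v] by (simp add: F_def)
  have cF: "continuous_on {a..b} F"
    unfolding F_def by (rule indefinite_integral_continuous_1[OF k])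
  \<comment> \<open>The primitive of \<open>k\<close> is a modulus of continuity for \<open>f\<close>.\<close>
  have le: "dist (f y) (f x) \<le> dist (F y) (F x)" if "x \<in> {a..b}" "y \<in> {a..b}" for x y
    using that inc[of x y] inc[of y x] F[of x y] F[of y x]
    by (cases "x \<le> y") (auto simp: dist_norm norm_minus_commute)
  show ?thesis
    unfolding continuous_on_iff
    by (meson cF[unfolded continuous_on_iff] le order_le_less_trans)
qed

lemma dominated_increments_bounded:
  assumes "dominated_increments a b f"
  obtains B where "B > 0" "\<And>x. x \<in> {a..b} \<Longrightarrow> norm (f x) \<le> B"
  using compact_imp_bounded[OF compact_continuous_image[OF dominated_increments_continuous[OF assms] compact_Icc]]
  unfolding bounded_pos by auto

lemma dominated_increments_integral:
  fixes g :: "real \<Rightarrow> 'a::euclidean_space"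
  assumes g: "g absolutely_integrable_on {a..b}"
  shows "dominated_increments a b (\<lambda>x. integral {a..x} g)"
  unfolding dominated_increments_def
proof (intro exI conjI allI impI)
  show "(\<lambda>x. norm (g x)) integrable_on {a..b}"
    using g absolutely_integrable_on_def by blast
  fix u v assume uv: "a \<le> u" "u \<le> v" "v \<le> b"
  have gi: "g integrable_on {a..v}" and gu: "g absolutely_integrable_on {u..v}"
    using g uv integrable_on_subinterval[of g "{a..b}" a v] absolutely_integrable_on_subinterval[OF g, of u v]
    by (auto simp: absolutely_integrable_on_def)
  have "integral {a..v} g - integral {a..u} g = integral {u..v} g"
    using Henstock_Kurzweil_Integration.integral_combine[of a u v g] uv gi by (simp add: algebra_simps)
  moreover have "norm (integral {u..v} g) \<le> integral {u..v} (\<lambda>x. norm (g x))"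
    using gu by (intro integral_norm_bound_integral) (auto simp: absolutely_integrable_on_def)
  ultimately show "norm (integral {a..v} g - integral {a..u} g) \<le> integral {u..v} (\<lambda>x. norm (g x))"
    by simp
qed

lemma dominated_increments_lipschitz:
  assumes f: "dominated_increments a b f"
    and L: "0 \<le> L" "\<And>u v. \<lbrakk>u \<in> {a..b}; v \<in> {a..b}\<rbrakk> \<Longrightarrow> norm (h v - h u) \<le> L * norm (f v - f u)"
  shows "dominated_increments a b h"
proof -
  obtain k :: "real \<Rightarrow> real" where k: "k integrable_on {a..b}"
    and inc: "\<And>u v. \<lbrakk>a \<le> u; u \<le> v; v \<le> b\<rbrakk> \<Longrightarrow> norm (f v - f u) \<le> integral {u..v} k"
    using f unfolding dominated_increments_def by blast
  show ?thesis
    unfolding dominated_increments_def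
  proof (intro exI conjI allI impI)
    show "(\<lambda>x. L * k x) integrable_on {a..b}" using k by (rule integrable_on_mult_right)
    fix u v assume uv: "a \<le> u" "u \<le> v" "v \<le> b"
    then have "norm (h v - h u) \<le> L * norm (f v - f u)" using L(2) by simp
    also have "\<dots> \<le> L * integral {u..v} k" using inc uv L(1) by (simp add: mult_left_mono)
    finally show "norm (h v - h u) \<le> integral {u..v} (\<lambda>x. L * k x)" by simp
  qed
qed

lemma dominated_increments_mult:
  fixes f g :: "real \<Rightarrow> 'a::real_normed_algebra"
  assumes f: "dominated_increments a b f" and g: "dominated_increments a b g"
  shows "dominated_increments a b (\<lambda>x. f x * g x)"
proof -
  obtain k :: "real \<Rightarrow> real" where k: "k integrable_on {a..b}"
    and inc: "\<And>u v. \<lbrakk>a \<le> u; u \<le> v; v \<le> b\<rbrakk> \<Longrightarrow> norm (f v - f u) \<le> integral {u..v} k"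
    using f unfolding dominated_increments_def by blast
  obtain k' :: "real \<Rightarrow> real" where k': "k' integrable_on {a..b}"
    and inc': "\<And>u v. \<lbrakk>a \<le> u; u \<le> v; v \<le> b\<rbrakk> \<Longrightarrow> norm (g v - g u) \<le> integral {u..v} k'"
    using g unfolding dominated_increments_def by blast
  obtain B where B: "B > 0" "\<And>x. x \<in> {a..b} \<Longrightarrow> norm (f x) \<le> B"
    using dominated_increments_bounded[OF f] by blast
  obtain B' where B': "B' > 0" "\<And>x. x \<in> {a..b} \<Longrightarrow> norm (g x) \<le> B'"
    using dominated_increments_bounded[OF g] by blast
  show ?thesis
    unfolding dominated_increments_def
  proof (intro exI conjI allI impI)
    show "(\<lambda>x. B * k' x + B' * k x) integrable_on {a..b}" using k k'
      by (intro integrable_add integrable_on_mult_right)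
    fix u v assume uv: "a \<le> u" "u \<le> v" "v \<le> b"
    have i: "k integrable_on {u..v}" "k' integrable_on {u..v}"
      using k k' uv integrable_on_subinterval[of _ "{a..b}" u v] by auto
    have "norm (f v * g v - f u * g u) = norm (f v * (g v - g u) + (f v - f u) * g u)"
      by (simp add: algebra_simps)
    also have "\<dots> \<le> norm (f v) * norm (g v - g u) + norm (f v - f u) * norm (g u)"
      by (intro order_trans[OF norm_triangle_ineq] add_mono norm_mult_ineq)
    also have "\<dots> \<le> B * integral {u..v} k' + integral {u..v} k * B'"
      using B B' uv inc[OF uv] inc'[OF uv] order_trans[OF norm_ge_zero inc[OF uv]]
      by (intro add_mono mult_mono) auto
    also have "\<dots> = integral {u..v} (\<lambda>x. B * k' x + B' * k x)"
      using i by (subst integral_add) (auto intro!: integrable_on_mult_right)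
    finally show "norm (f v * g v - f u * g u) \<le> integral {u..v} (\<lambda>x. B * k' x + B' * k x)" .
  qed
qed

lemma dominated_increments_exp:
  fixes f :: "real \<Rightarrow> complex"
  assumes f: "dominated_increments a b f"
  shows "dominated_increments a b (\<lambda>x. exp (f x))"
proof -
  obtain B where B: "B > 0" "\<And>x. x \<in> {a..b} \<Longrightarrow> norm (f x) \<le> B"
    using dominated_increments_bounded[OF f] by blast
  show ?thesis
  proof (rule dominated_increments_lipschitz[OF f])
    show "0 \<le> exp B" by simp
    fix u v assume "u \<in> {a..b}" "v \<in> {a..b}"
    with B have uv: "f u \<in> cball 0 B" "f v \<in> cball 0 B" by auto
    show "norm (exp (f v) - exp (f u)) \<le> exp B * norm (f v - f u)"
    proof (rule field_differentiable_bound[OF convex_cball _ _ uv(2) uv(1)])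
      show "(exp has_field_derivative exp z) (at z within cball 0 B)" for z :: complex
        by (rule DERIV_subset[OF DERIV_exp]) auto
      show "norm (exp z) \<le> exp B" if "z \<in> cball 0 B" for z :: complex
        using that norm_exp[of z] by (auto intro: order_trans)
    qed
  qed
qed

section \<open>Indefinite integrals and linear differential equations\<close>

text \<open>
  Lebesgue's differentiation theorem on a half-line.
\<close>
lemma indefinite_integral_has_vector_derivative_ae:
  fixes g :: "real \<Rightarrow> 'a::euclidean_space"
  assumes g: "\<And>T. g integrable_on {a..T}"
  obtains N where "negligible N"
    "\<And>t. \<lbrakk>a \<le> t; t \<notin> N\<rbrakk> \<Longrightarrow> ((\<lambda>x. integral {a..x} g) has_vector_derivative g t) (at t within {a..})"
proof -
  define f where "f = (\<lambda>x. if x \<in> {a..} then g x else 0)"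
  have f: "f integrable_on cbox u v" for u v
  proof -
    have "{a..} \<inter> {u..v} = {max a u..v}" by auto
    then have "g integrable_on ({a..} \<inter> {u..v})"
      using integrable_on_subinterval[OF g[of v], of "max a u" v] by simp
    then show ?thesis unfolding f_def box_real integrable_restrict_Int .
  qed
  \<comment> \<open>The differentiation theorem for cubes with corner \<open>x\<close> only gives right derivatives;
    the left ones come from the reflected function.\<close>
  have fm: "(\<lambda>x. f (- x)) integrable_on cbox u v" for u v
    using f[of "-v" "-u"] Henstock_Kurzweil_Integration.integrable_reflect_real[where f = f and a = "-v" and b = "-u"] by simp
  obtain N1 where N1: "negligible N1"
    "\<And>x e. \<lbrakk>x \<notin> N1; 0 < e\<rbrakk> \<Longrightarrow> \<exists>d>0. \<forall>h. 0 < h \<and> h < d \<longrightarrow>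
                norm(integral (cbox x (x + h *\<^sub>R One)) f /\<^sub>R h ^ DIM(real) - f x) < e"
    using integrable_ccontinuous_explicit[OF f] by blast
  obtain N2 where N2: "negligible N2"
    "\<And>x e. \<lbrakk>x \<notin> N2; 0 < e\<rbrakk> \<Longrightarrow> \<exists>d>0. \<forall>h. 0 < h \<and> h < d \<longrightarrow>
                norm(integral (cbox x (x + h *\<^sub>R One)) (\<lambda>x. f (- x)) /\<^sub>R h ^ DIM(real) - f (- x)) < e"
    using integrable_ccontinuous_explicit[OF fm] by blast
  show ?thesis
  proof (rule that)
    have "negligible (uminus ` N2)"
      by (rule negligible_locally_Lipschitz_image[OF _ N2(1)])
         (auto intro!: exI[of _ UNIV] exI[of _ "1::real"] simp: norm_minus_commute)
    then show "negligible (N1 \<union> uminus ` N2)" using N1(1) by simp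
    fix t assume t: "a \<le> t" "t \<notin> N1 \<union> uminus ` N2"
    then have tN: "t \<notin> N1" "- t \<notin> N2" by (auto intro: rev_image_eqI)
    have diff: "integral {a..v} g - integral {a..u} g = integral {u..v} f" if "a \<le> u" "u \<le> v" for u v
    proof -
      have "integral {u..v} f = integral {u..v} g"
        using that by (intro integral_cong) (auto simp: f_def)
      then show ?thesis
        using Henstock_Kurzweil_Integration.integral_combine[of a u v g] that g[of v] by (simp add: algebra_simps)
    qed
    have scale: "norm (I - h *\<^sub>R w) \<le> e * h" if "norm (I /\<^sub>R h - w) < e" "h > 0" for I w :: 'a and h e
    proof -
      have "norm (I - h *\<^sub>R w) = norm (h *\<^sub>R (I /\<^sub>R h - w))"
        using that by (simp add: algebra_simps)
      also have "\<dots> = h * norm (I /\<^sub>R h - w)" using that by simp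
      finally show ?thesis using that by (simp add: mult.commute)
    qed
    show "((\<lambda>x. integral {a..x} g) has_vector_derivative g t) (at t within {a..})"
      unfolding has_vector_derivative_def has_derivative_within_alt
    proof (intro conjI allI impI)
      show "bounded_linear (\<lambda>h. h *\<^sub>R g t)" by (rule bounded_linear_scaleR_left)
      fix e :: real assume e: "e > 0"
      obtain d1 where d1: "d1 > 0" "\<And>h. \<lbrakk>0 < h; h < d1\<rbrakk> \<Longrightarrow>
           norm (integral {t..t + h} f /\<^sub>R h - f t) < e"
        using N1(2)[OF tN(1) e] by auto
      obtain d2 where d2: "d2 > 0" "\<And>h. \<lbrakk>0 < h; h < d2\<rbrakk> \<Longrightarrow>
           norm (integral {-t..-t + h} (\<lambda>x. f (- x)) /\<^sub>R h - f t) < e"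
        using N2(2)[OF tN(2) e] by auto
      have ft: "f t = g t" using t by (simp add: f_def)
      show "\<exists>d>0. \<forall>y\<in>{a..}. norm (y - t) < d \<longrightarrow>
          norm (integral {a..y} g - integral {a..t} g - (y - t) *\<^sub>R g t) \<le> e * norm (y - t)"
      proof (intro exI[of _ "min d1 d2"] conjI ballI impI)
        show "min d1 d2 > 0" using d1 d2 by simp
        fix y assume y: "y \<in> {a..}" "norm (y - t) < min d1 d2"
        consider "y = t" | "y > t" | "y < t" by linarith
        then show "norm (integral {a..y} g - integral {a..t} g - (y - t) *\<^sub>R g t) \<le> e * norm (y - t)"
        proof cases
          case 2
          then have "norm (integral {t..y} f - (y - t) *\<^sub>R g t) \<le> e * (y - t)"
            using d1(2)[of "y - t"] y by (intro scale) (auto simp: ft)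
          then show ?thesis using diff[of t y] 2 t by simp
        next
          case 3
          have "integral {-t..-y} (\<lambda>x. f (- x)) = integral {y..t} f" by simp
          then have "norm (integral {y..t} f - (t - y) *\<^sub>R g t) \<le> e * (t - y)"
            using d2(2)[of "t - y"] y 3 by (intro scale) (auto simp: ft)
          moreover have "integral {a..y} g - integral {a..t} g - (y - t) *\<^sub>R g t
              = - (integral {y..t} f - (t - y) *\<^sub>R g t)"
            using diff[of y t] 3 y by (simp add: algebra_simps)
          ultimately show ?thesis using 3 by (simp only: norm_minus_cancel) simp
        qed auto
      qed
    qed
  qed
qed

lemma absolutely_continuous_on_integral:
  fixes g :: "real \<Rightarrow> 'a::euclidean_space"
  assumes g: "g absolutely_integrable_on {a..b}"
  shows "absolutely_continuous_on {a..b} (\<lambda>x. integral {a..x} g)"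
  unfolding absolutely_continuous_on_def
proof (intro allI impI)
  fix e :: real assume e: "e > 0"
  \<comment> \<open>Truncate \<open>norm g\<close> at a height \<open>n\<close> beyond which its integral is below \<open>e / 2\<close>; the
    truncated part contributes at most \<open>n\<close> times the total length.\<close>
  define H where "H = (\<lambda>x. indicator {a..b} x * norm (g x))"
  have H: "integrable lebesgue H"
    using set_integrable_norm[OF g] by (simp add: H_def set_integrable_def)
  have Hn: "integrable lebesgue (\<lambda>x. min (H x) (real n))" for n
    by (rule Bochner_Integration.integrable_bound[OF H]) (use H in \<open>auto simp: H_def\<close>)
  have "(\<lambda>n. LINT x|lebesgue. H x - min (H x) (real n)) \<longlonglongrightarrow> (LINT x::real|lebesgue. (0::real))"
  proof (rule Bochner_Integration.integral_dominated_convergence[where w = H and s = "\<lambda>n x. H x - min (H x) (real n)" and f = "\<lambda>x. 0" and M = lebesgue])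
    show "AE x in lebesgue. (\<lambda>n. H x - min (H x) (real n)) \<longlonglongrightarrow> 0"
    proof (intro AE_I2 tendsto_eventually)
      fix x show "\<forall>\<^sub>F n in sequentially. H x - min (H x) (real n) = 0"
        using eventually_ge_at_top[of "nat \<lceil>H x\<rceil>"] by eventually_elim linarith
    qed
  qed (use H Hn in \<open>auto simp: H_def intro!: AE_I2\<close>)
  then have "\<forall>\<^sub>F n in sequentially. (LINT x|lebesgue. H x - min (H x) (real n)) < e / 2"
    by (rule order_tendstoD(2)) (use e in simp)
  then obtain n where n: "(LINT x|lebesgue. H x - min (H x) (real n)) < e / 2"
    using eventually_happens'[OF sequentially_bot] by blast
  show "\<exists>\<delta>>0. \<forall>I. finite I \<longrightarrow> (\<forall>(u,v)\<in>I. u \<le> v \<and> {u..v} \<subseteq> {a..b}) \<longrightarrow>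
        pairwise (\<lambda>(u,v) (u',v'). disjnt {u<..<v} {u'<..<v'}) I \<longrightarrow>
        (\<Sum>(u,v)\<in>I. v - u) < \<delta> \<longrightarrow>
        (\<Sum>(u,v)\<in>I. norm (integral {a..v} g - integral {a..u} g)) < e"
  proof (intro exI[of _ "e / (2 * (real n + 1))"] conjI allI impI)
    show "e / (2 * (real n + 1)) > 0" using e by simp
    fix I :: "(real \<times> real) set"
    assume fin: "finite I" and sub: "\<forall>(u,v)\<in>I. u \<le> v \<and> {u..v} \<subseteq> {a..b}"
      and disj: "pairwise (\<lambda>(u,v) (u',v'). disjnt {u<..<v} {u'<..<v'}) I"
      and small: "(\<Sum>(u,v)\<in>I. v - u) < e / (2 * (real n + 1))"
    define J where "J = (\<lambda>(u,v). {u<..<v::real})"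
    define R where "R = (\<lambda>x. H x - min (H x) (real n))"
    have R: "integrable lebesgue R" unfolding R_def using H Hn by (rule Bochner_Integration.integrable_diff)
    have R0: "R x \<ge> 0" for x by (simp add: R_def)
    have Rs: "set_integrable lebesgue (J z) R" for z
      using set_integrable_subset[of lebesgue UNIV R "J z"] R
      by (auto simp: set_integrable_def J_def split: prod.splits)
    have inc: "norm (integral {a..v} g - integral {a..u} g) \<le> (LINT x:J (u,v)|lebesgue. R x) + real n * (v - u)"
      if "(u,v) \<in> I" for u v
    proof -
      have uv: "u \<le> v" "{u..v} \<subseteq> {a..b}" "a \<le> u" "v \<le> b" using that sub by auto
      have "integral {a..v} g - integral {a..u} g = integral {u..v} g"
        using Henstock_Kurzweil_Integration.integral_combine[of a u v g] uv
          integrable_on_subinterval[of g "{a..b}" a v] set_lebesgue_integral_eq_integral(1)[OF g]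
        by (simp add: algebra_simps)
      also have "\<dots> = integral {u<..<v} g" by (simp add: integral_open_interval_real)
      also have "\<dots> = (LINT x:{u<..<v}|lebesgue. g x)"
        by (intro set_lebesgue_integral_eq_integral(2)[symmetric] set_integrable_subset[OF g]) (use uv in auto)
      finally have "norm (integral {a..v} g - integral {a..u} g) = norm (LINT x:{u<..<v}|lebesgue. g x)"
        by simp
      also have "\<dots> \<le> (LINT x:{u<..<v}|lebesgue. norm (g x))"
        by (intro set_integral_norm_bound set_integrable_subset[OF g]) (use uv in auto)
      also have "\<dots> \<le> (LINT x:{u<..<v}|lebesgue. R x + real n)"
      proof (rule set_integral_mono)
        show "set_integrable lebesgue {u<..<v} (\<lambda>x. norm (g x))"
          by (intro set_integrable_norm set_integrable_subset[OF g]) (use uv in auto)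
        show "set_integrable lebesgue {u<..<v} (\<lambda>x. R x + real n)"
          using Rs[of "(u,v)"] by (intro set_integral_add) (auto simp: J_def intro!: integrable_on_const)
        fix x assume "x \<in> {u<..<v}"
        then have "x \<in> {a..b}" using uv by auto
        then show "norm (g x) \<le> R x + real n" by (auto simp: R_def H_def)
      qed
      also have "\<dots> = (LINT x:J (u,v)|lebesgue. R x) + real n * (v - u)"
        using Rs[of "(u,v)"] uv by (subst set_integral_add) (auto simp: J_def set_lebesgue_integral_def mult.commute)
      finally show ?thesis .
    qed
    have "(\<Sum>(u,v)\<in>I. norm (integral {a..v} g - integral {a..u} g))
        \<le> (\<Sum>z\<in>I. (LINT x:J z|lebesgue. R x) + real n * (case z of (u,v) \<Rightarrow> v - u))"
      by (rule sum_mono) (use inc in auto)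
    also have "\<dots> = (\<Sum>z\<in>I. (LINT x:J z|lebesgue. R x)) + real n * (\<Sum>(u,v)\<in>I. v - u)"
      by (simp add: sum.distrib sum_distrib_left)
    also have "(\<Sum>z\<in>I. (LINT x:J z|lebesgue. R x)) = (LINT x|lebesgue. (\<Sum>z\<in>I. indicator (J z) x * R x))"
      using Rs by (simp add: set_lebesgue_integral_def set_integrable_def)
    also have "\<dots> \<le> (LINT x|lebesgue. R x)"
    proof (rule integral_mono[OF _ R])
      show "integrable lebesgue (\<lambda>x. \<Sum>z\<in>I. indicator (J z) x * R x)"
        using Rs by (simp add: set_integrable_def)
      have dj: "disjoint_family_on J I"
        unfolding disjoint_family_on_def
      proof (intro ballI impI)
        fix z z' assume "z \<in> I" "z' \<in> I" "z \<noteq> z'"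
        from pairwiseD[OF disj this] show "J z \<inter> J z' = {}"
          unfolding J_def disjnt_def by (auto split: prod.splits)
      qed
      show "(\<Sum>z\<in>I. indicator (J z) x * R x) \<le> R x" for x
      proof -
        have "(\<Sum>z\<in>I. indicator (J z) x :: real) = indicator (\<Union>z\<in>I. J z) x"
          by (simp add: indicator_UN_disjoint[OF fin dj])
        also have "\<dots> \<le> 1" by (simp add: indicator_def)
        finally show ?thesis
          using mult_right_mono[of "\<Sum>z\<in>I. indicator (J z) x" 1 "R x"] R0[of x] by (simp add: sum_distrib_right)
      qed
    qed
    also have "\<dots> < e / 2" using n by (simp add: R_def)
    also have "real n * (\<Sum>(u,v)\<in>I. v - u) \<le> e / 2"
    proof -
      have "real n * (\<Sum>(u,v)\<in>I. v - u) \<le> real n * (e / (2 * (real n + 1)))"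
        using small by (intro mult_left_mono) auto
      also have "\<dots> \<le> e / 2" using e by (simp add: field_simps)
      finally show ?thesis .
    qed
    finally show "(\<Sum>(u,v)\<in>I. norm (integral {a..v} g - integral {a..u} g)) < e" by simp
  qed
qed

lemma absolutely_continuous_on_imp_continuous_on:
  fixes f :: "real \<Rightarrow> 'a::real_normed_vector"
  assumes ac: "absolutely_continuous_on {a..b} f"
  shows "continuous_on {a..b} f"
  unfolding continuous_on_iff
proof (intro ballI allI impI)
  fix x and \<epsilon> :: real assume x: "x \<in> {a..b}" and "\<epsilon> > 0"
  then obtain \<delta> where "\<delta> > 0" and \<delta>: "\<And>I. \<lbrakk>finite I; \<forall>(u,v)\<in>I. u \<le> v \<and> {u..v} \<subseteq> {a..b};
      pairwise (\<lambda>(u,v) (u',v'). disjnt {u<..<v} {u'<..<v'}) I; (\<Sum>(u,v)\<in>I. v - u) < \<delta>\<rbrakk> \<Longrightarrow>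
      (\<Sum>(u,v)\<in>I. norm (f v - f u)) < \<epsilon>"
    using ac unfolding absolutely_continuous_on_def by meson
  have *: "dist (f v) (f u) < \<epsilon>" if "u \<le> v" "{u..v} \<subseteq> {a..b}" "v - u < \<delta>" for u v
    using \<delta>[of "{(u, v)}"] that by (simp add: dist_norm)
  have "dist (f y) (f x) < \<epsilon>" if "y \<in> {a..b}" "dist y x < \<delta>" for y
    using that x *[of x y] *[of y x] by (cases "x \<le> y") (auto simp: dist_real_def dist_commute)
  with \<open>\<delta> > 0\<close> show "\<exists>\<delta>>0. \<forall>y\<in>{a..b}. dist y x < \<delta> \<longrightarrow> dist (f y) (f x) < \<epsilon>" by blast
qed

lemma linear_ode_solution:
  fixes X \<alpha> :: "real \<Rightarrow> complex"
  assumes "a \<le> b" and X: "dominated_increments a b X" and \<alpha>: "\<alpha> absolutely_integrable_on {a..b}"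
    and N: "negligible N"
    and der: "\<And>x. \<lbrakk>x \<in> {a..b}; x \<notin> N\<rbrakk> \<Longrightarrow> (X has_vector_derivative (\<alpha> x * X x)) (at x within {a..b})"
  shows "X b = X a * exp (integral {a..b} \<alpha>)"
proof -
  define \<beta> where "\<beta> = (\<lambda>x. if x \<in> {a..b} then \<alpha> x else 0)"
  have \<beta>: "\<beta> absolutely_integrable_on S" if "S \<in> sets lebesgue" for S
  proof -
    have "\<beta> absolutely_integrable_on UNIV"
      unfolding \<beta>_def absolutely_integrable_restrict_UNIV by (rule \<alpha>)
    then show ?thesis by (rule set_integrable_subset) (use that in auto)
  qed
  have \<beta>i: "\<beta> integrable_on {a..T}" for T
    by (intro set_lebesgue_integral_eq_integral(1) \<beta>) simp
  obtain N' where N': "negligible N'"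
    "\<And>t. \<lbrakk>a \<le> t; t \<notin> N'\<rbrakk> \<Longrightarrow> ((\<lambda>x. integral {a..x} \<beta>) has_vector_derivative \<beta> t) (at t within {a..})"
    using indefinite_integral_has_vector_derivative_ae[OF \<beta>i] by blast
  \<comment> \<open>The integrating factor: the product \<open>Y\<close> has derivative \<open>0\<close> almost everywhere.\<close>
  define E where "E = (\<lambda>t. exp (- integral {a..t} \<beta>))"
  define Y where "Y = (\<lambda>t. X t * E t)"
  have "dominated_increments a b (\<lambda>t. integral {a..t} \<beta>)"
    by (rule dominated_increments_integral) (simp add: \<beta>)
  then have "dominated_increments a b (\<lambda>t. - integral {a..t} \<beta>)"
    by (rule dominated_increments_lipschitz[where L = 1])
       (auto simp: norm_minus_commute)
  then have "dominated_increments a b E"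
    unfolding E_def by (rule dominated_increments_exp)
  then have Y: "dominated_increments a b Y"
    unfolding Y_def by (rule dominated_increments_mult[OF X])
  have "((\<lambda>_. 0) has_integral (Y b - Y a)) {a..b}"
  proof (rule dominated_increments_has_integral[OF \<open>a \<le> b\<close> Y])
    show "negligible (N \<union> N')" using N N' by simp
    fix x assume x: "x \<in> {a..b}" "x \<notin> N \<union> N'"
    have "((\<lambda>x. integral {a..x} \<beta>) has_vector_derivative \<beta> x) (at x within {a..b})"
      using N'(2)[of x] x by (auto intro: has_vector_derivative_within_subset)
    then have "((\<lambda>x. - integral {a..x} \<beta>) has_vector_derivative - \<beta> x) (at x within {a..b})"
      by (rule has_vector_derivative_minus)
    from field_vector_diff_chain_within[OF this, of exp "E x"]
    have E: "(E has_vector_derivative (- \<beta> x * E x)) (at x within {a..b})"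
      unfolding E_def o_def by (auto intro: DERIV_subset[OF DERIV_exp])
    have "(Y has_vector_derivative (X x * (- \<beta> x * E x) + \<alpha> x * X x * E x)) (at x within {a..b})"
      unfolding Y_def by (rule has_vector_derivative_mult[OF der E]) (use x in auto)
    moreover have "\<beta> x = \<alpha> x" using x by (simp add: \<beta>_def)
    ultimately show "(Y has_vector_derivative 0) (at x within {a..b})" by (simp add: algebra_simps)
  qed
  then have "Y b = Y a" using has_integral_0 has_integral_unique by fastforce
  moreover have "integral {a..b} \<beta> = integral {a..b} \<alpha>"
    by (rule integral_cong) (auto simp: \<beta>_def)
  moreover have "Y a = X a" by (simp add: Y_def E_def)
  ultimately show ?thesis
    by (auto simp: Y_def E_def exp_minus field_simps)
qed

text \<open>
  Stability of linear equations under dominated pointwise convergence of the coefficients. Both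
  halves of the theorem apply it to a sequence of trajectories whose starting points approach
  the fixed point.
\<close>
lemma linear_ode_limit:
  fixes X \<alpha> :: "nat \<Rightarrow> real \<Rightarrow> complex"
  assumes "a \<le> b" and X: "\<And>n. dominated_increments a b (X n)"
    and N: "\<And>n. negligible (N n)"
    and der: "\<And>n r. \<lbrakk>r \<in> {a..b}; r \<notin> N n\<rbrakk> \<Longrightarrow> (X n has_vector_derivative (\<alpha> n r * X n r)) (at r within {a..b})"
    and meas: "\<And>n. set_borel_measurable lebesgue {a..b} (\<alpha> n)"
    and h: "h integrable_on {a..b}" and le: "\<And>n r. r \<in> {a..b} \<Longrightarrow> norm (\<alpha> n r) \<le> h r"
    and lim: "\<And>r. r \<in> {a..b} \<Longrightarrow> (\<lambda>n. \<alpha> n r) \<longlonglongrightarrow> \<beta> r"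
    and nz: "\<And>n. X n a \<noteq> 0"
  shows "(\<lambda>n. X n b / X n a) \<longlonglongrightarrow> exp (integral {a..b} \<beta>)"
proof -
  have h0: "h r \<ge> 0" if "r \<in> {a..b}" for r using le[OF that, of 0] norm_ge_zero order_trans by blast
  then have "h absolutely_integrable_on {a..b}"
    using h by (auto intro: nonnegative_absolutely_integrable_1)
  then have \<alpha>: "\<alpha> n absolutely_integrable_on {a..b}" for n
    by (rule set_integrable_bound[OF _ meas]) (use le h0 in \<open>auto intro!: AE_I2\<close>)
  have "X n b = X n a * exp (integral {a..b} (\<alpha> n))" for n
    by (rule linear_ode_solution[OF \<open>a \<le> b\<close> X \<alpha> N der])
  then have "X n b / X n a = exp (integral {a..b} (\<alpha> n))" for n using nz by simp
  moreover have "(\<lambda>n. integral {a..b} (\<alpha> n)) \<longlonglongrightarrow> integral {a..b} \<beta>"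
    by (rule dominated_convergence(2)[OF _ h le lim])
       (use \<alpha> set_lebesgue_integral_eq_integral(1) in blast)
  ultimately show ?thesis by (simp add: tendsto_exp)
qed

section \<open>Local \<open>L\<^sup>d\<close> spaces and measurability\<close>

text \<open>
  \<open>f\<close> and \<open>g\<close> may have different value types, so that real and complex functions can be
  compared.
\<close>
lemma L_on_dominated:
  fixes f :: "real \<Rightarrow> 'a::euclidean_space" and g :: "real \<Rightarrow> 'b::euclidean_space"
  assumes f: "L_on d S f" and S: "S \<in> sets lebesgue" and g: "set_borel_measurable lebesgue S g"
    and "0 \<le> C" and le: "\<And>t. t \<in> S \<Longrightarrow> norm (g t) \<le> C * norm (f t)"
  shows "L_on d S g"
proof (cases "d = \<infinity>")
  case True
  then obtain B where B: "AE t in lebesgue. t \<in> S \<longrightarrow> norm (f t) \<le> B"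
    using f by (auto simp: L_on_def)
  have "AE t in lebesgue. t \<in> S \<longrightarrow> norm (g t) \<le> C * B"
    using B by eventually_elim (use le \<open>0 \<le> C\<close> mult_left_mono order_trans in blast)
  then show ?thesis using True g by (auto simp: L_on_def)
next
  case False
  define e where "e = enn2real d"
  have e: "e \<ge> 0" by (simp add: e_def)
  have fe: "set_integrable lebesgue S (\<lambda>t. norm (f t) powr e)"
    using f False by (simp add: L_on_def e_def)
  have "set_integrable lebesgue S (\<lambda>t. norm (g t) powr e)"
  proof (rule set_integrable_bound)
    show "set_integrable lebesgue S (\<lambda>t. C powr e * norm (f t) powr e)"
      using fe by (rule set_integrable_mult_right) 
    have "(\<lambda>t. norm (indicator S t *\<^sub>R g t) powr e) \<in> borel_measurable lebesgue"
      using g unfolding set_borel_measurable_def by measurable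
    then have "(\<lambda>t. indicator S t * norm (indicator S t *\<^sub>R g t) powr e) \<in> borel_measurable lebesgue"
      using S by measurable
    then show "set_borel_measurable lebesgue S (\<lambda>t. norm (g t) powr e)"
      unfolding set_borel_measurable_def
      by (rule measurable_cong[THEN iffD1, rotated]) (auto simp: indicator_def)
    show "AE t in lebesgue. t \<in> S \<longrightarrow> norm (norm (g t) powr e) \<le> norm (C powr e * norm (f t) powr e)"
    proof (intro AE_I2 impI)
      fix t assume "t \<in> S"
      then have "norm (g t) powr e \<le> (C * norm (f t)) powr e"
        using le e by (intro powr_mono2) auto
      also have "\<dots> = C powr e * norm (f t) powr e"
        using \<open>0 \<le> C\<close> by (simp add: powr_mult)
      finally show "norm (norm (g t) powr e) \<le> norm (C powr e * norm (f t) powr e)" by simp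
    qed
  qed
  then show ?thesis using False g by (auto simp: L_on_def e_def)
qed

text \<open>
  On an interval of finite length \<open>L\<^sup>d\<close> is contained in \<open>L\<^sup>1\<close>, because \<open>x \<le> 1 + x powr e\<close> for
  \<open>x \<ge> 0\<close> and \<open>e \<ge> 1\<close>.
\<close>
lemma L_on_imp_absolutely_integrable:
  fixes f :: "real \<Rightarrow> 'a::euclidean_space"
  assumes f: "L_on d {a..b} f" and d: "1 \<le> d"
  shows "f absolutely_integrable_on {a..b}"
proof -
  have meas: "set_borel_measurable lebesgue {a..b} f" using f by (simp add: L_on_def)
  have const: "set_integrable lebesgue {a..b} (\<lambda>_. c)" for c :: real
    by (auto intro: integrable_on_const)
  show ?thesis
  proof (cases "d = \<infinity>")
    case True
    then obtain B where B: "AE t in lebesgue. t \<in> {a..b} \<longrightarrow> norm (f t) \<le> B"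
      using f unfolding L_on_def by auto
    show ?thesis
    proof (rule set_integrable_bound[OF const meas])
      show "AE t in lebesgue. t \<in> {a..b} \<longrightarrow> norm (f t) \<le> norm B"
        using B by eventually_elim auto
    qed
  next
    case False
    define e where "e = enn2real d"
    have e: "e \<ge> 1" unfolding e_def using False d
      by (metis enn2real_mono enn2real_1 infinity_ennreal_def top.not_eq_extremum)
    have fe: "set_integrable lebesgue {a..b} (\<lambda>t. norm (f t) powr e)"
      using f False by (simp add: L_on_def e_def)
    show ?thesis
    proof (rule set_integrable_bound[OF _ meas])
      show "set_integrable lebesgue {a..b} (\<lambda>t. 1 + norm (f t) powr e)"
        using const fe by (rule set_integral_add(1))
      show "AE t in lebesgue. t \<in> {a..b} \<longrightarrow> norm (f t) \<le> norm (1 + norm (f t) powr e)"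
      proof (intro AE_I2 impI)
        fix t
        show "norm (f t) \<le> norm (1 + norm (f t) powr e)"
        proof (cases "norm (f t) \<le> 1")
          case False
          then have "norm (f t) powr 1 \<le> norm (f t) powr e" using e by (intro powr_mono) auto
          then show ?thesis using False by simp
        qed (auto intro: order_trans)
      qed
    qed
  qed
qed

text \<open>
  Superposition of a Caratheodory function with a continuous curve: approximate the curve by
  step functions.
\<close>
lemma set_borel_measurable_caratheodory:
  fixes p :: "'a::topological_space \<Rightarrow> real \<Rightarrow> 'b::euclidean_space" and w :: "real \<Rightarrow> 'a"
  assumes meas: "\<And>z. z \<in> U \<Longrightarrow> set_borel_measurable lebesgue {a..b} (\<lambda>t. p z t)"
    and cont: "\<And>t. t \<in> {a..b} \<Longrightarrow> continuous_on U (\<lambda>z. p z t)"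
    and w: "continuous_on {a..b} w" "w ` {a..b} \<subseteq> U"
  shows "set_borel_measurable lebesgue {a..b} (\<lambda>t. p (w t) t)"
proof (cases "a \<le> b")
  case True
  define c where "c = (\<lambda>x::real. max a (min b x))"
  have c: "c x \<in> {a..b}" for x using True by (auto simp: c_def)
  \<comment> \<open>\<open>r n\<close> takes countably many values, so \<open>\<lambda>t. p (w (r n t)) t\<close> is a countable patchwork of
    measurable functions; \<open>c\<close> keeps the grid points inside \<open>{a..b}\<close>.\<close>
  define r where "r = (\<lambda>n t. c (real_of_int \<lfloor>real (Suc n) * t\<rfloor> / real (Suc n)))"
  have r: "(\<lambda>n. r n t) \<longlonglongrightarrow> t" if "t \<in> {a..b}" for t
  proof -
    have "(\<lambda>n. real_of_int \<lfloor>real (Suc n) * t\<rfloor> / real (Suc n)) \<longlonglongrightarrow> t"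
    proof (rule real_tendsto_sandwich)
      show "\<forall>\<^sub>F n in sequentially. t - 1 / real (Suc n) \<le> real_of_int \<lfloor>real (Suc n) * t\<rfloor> / real (Suc n)"
      proof (intro always_eventually allI)
        fix n
        have "real (Suc n) * t - 1 \<le> real_of_int \<lfloor>real (Suc n) * t\<rfloor>" by linarith
        then have "(real (Suc n) * t - 1) / real (Suc n) \<le> real_of_int \<lfloor>real (Suc n) * t\<rfloor> / real (Suc n)"
          by (rule divide_right_mono) simp
        then show "t - 1 / real (Suc n) \<le> real_of_int \<lfloor>real (Suc n) * t\<rfloor> / real (Suc n)"
          by (simp add: diff_divide_distrib)
      qed
      show "\<forall>\<^sub>F n in sequentially. real_of_int \<lfloor>real (Suc n) * t\<rfloor> / real (Suc n) \<le> t"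
      proof (intro always_eventually allI)
        fix n
        have "real_of_int \<lfloor>real (Suc n) * t\<rfloor> / real (Suc n) \<le> (real (Suc n) * t) / real (Suc n)"
          by (intro divide_right_mono of_int_floor_le) simp
        then show "real_of_int \<lfloor>real (Suc n) * t\<rfloor> / real (Suc n) \<le> t" by simp
      qed
      have "(\<lambda>n. t - 1 / real (Suc n)) \<longlonglongrightarrow> t - 0"
        by (intro tendsto_intros LIMSEQ_Suc[OF lim_1_over_n])
      then show "(\<lambda>n. t - 1 / real (Suc n)) \<longlonglongrightarrow> t" by simp
    qed auto
    then have "(\<lambda>n. r n t) \<longlonglongrightarrow> c t"
      unfolding r_def c_def by (intro tendsto_intros)
    then show ?thesis using that by (auto simp: c_def)
  qed
  show ?thesis
    unfolding set_borel_measurable_def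
  proof (rule borel_measurable_LIMSEQ_metric)
    show "(\<lambda>t. indicat_real {a..b} t *\<^sub>R p (w (r n t)) t) \<in> borel_measurable lebesgue" for n
      unfolding r_def
    proof (rule measurable_compose_countable[where f = "\<lambda>i t. indicat_real {a..b} t *\<^sub>R p (w (c (real_of_int i / real (Suc n)))) t"])
      show "(\<lambda>t. indicat_real {a..b} t *\<^sub>R p (w (c (real_of_int i / real (Suc n)))) t) \<in> borel_measurable lebesgue" for i
        using meas[of "w (c (real_of_int i / real (Suc n)))"] w(2) c unfolding set_borel_measurable_def by blast
      have "(\<lambda>t::real. real (Suc n) * t) \<in> borel_measurable lborel" by measurable
      then have "(\<lambda>t::real. real (Suc n) * t) \<in> borel_measurable lebesgue"
        by (rule measurable_completion)
      then show "(\<lambda>t::real. \<lfloor>real (Suc n) * t\<rfloor>) \<in> measurable lebesgue (count_space UNIV)"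
        by measurable
    qed
    fix t
    show "(\<lambda>n. indicat_real {a..b} t *\<^sub>R p (w (r n t)) t) \<longlonglongrightarrow> indicat_real {a..b} t *\<^sub>R p (w t) t"
    proof (cases "t \<in> {a..b}")
      case True
      have rn: "r n t \<in> {a..b}" for n using c by (simp add: r_def)
      have 1: "(\<lambda>n. w (r n t)) \<longlonglongrightarrow> w t"
        using continuous_on_tendsto_compose[OF w(1) r[OF True] True] rn by simp
      have "(\<lambda>n. p (w (r n t)) t) \<longlonglongrightarrow> p (w t) t"
        by (rule continuous_on_tendsto_compose[OF cont[OF True] 1]) (use w(2) True rn in \<open>auto intro!: always_eventually simp: image_subset_iff\<close>)
      then show ?thesis by (intro tendsto_intros)
    qed auto
  qed
qed (auto simp: set_borel_measurable_def)

lemma set_borel_measurable_continuous_mult: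
  fixes f g :: "real \<Rightarrow> complex"
  assumes f: "continuous_on {a..b} f" and g: "set_borel_measurable lebesgue {a..b} g"
  shows "set_borel_measurable lebesgue {a..b} (\<lambda>r. f r * g r)"
proof -
  have "(\<lambda>r. indicat_real {a..b} r *\<^sub>R f r) \<in> borel_measurable lebesgue"
    using absolutely_integrable_continuous_real[OF f] unfolding set_integrable_def
    by (rule borel_measurable_integrable)
  then have "(\<lambda>r. (indicat_real {a..b} r *\<^sub>R f r) * (indicat_real {a..b} r *\<^sub>R g r)) \<in> borel_measurable lebesgue"
    using g unfolding set_borel_measurable_def by (rule borel_measurable_times)
  then show ?thesis unfolding set_borel_measurable_def
    by (rule measurable_cong[THEN iffD1, rotated]) (auto simp: indicator_def)
qed

section \<open>Holomorphic functions with nonnegative real part\<close>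

text \<open>
  Apply the Schwarz lemma to the Cayley transform of \<open>f\<close>. The imaginary part at the origin is
  subtracted so that the value there is real.
\<close>
lemma norm_le_of_Re_pos:
  assumes holf: "f holomorphic_on unit_disc" and pos: "\<And>z. z \<in> unit_disc \<Longrightarrow> 0 < Re (f z)"
    and z: "z \<in> unit_disc"
  shows "norm (f z - \<i> * Im (f 0)) * (1 - norm z) \<le> Re (f 0) * (1 + norm z)"
proof -
  define a where "a = Re (f 0)"
  define g where "g = (\<lambda>z. f z - \<i> * Im (f 0))"
  have a: "a > 0" using pos[of 0] by (simp add: a_def)
  have Reg: "Re (g z) > 0" if "z \<in> unit_disc" for z using pos[OF that] by (simp add: g_def)
  have g0: "g 0 = of_real a" by (simp add: g_def a_def complex_eq_iff)
  have holg: "g holomorphic_on unit_disc" unfolding g_def by (intro holomorphic_intros holf)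
  have lt: "norm (g z - a) < norm (g z + a)" if "z \<in> unit_disc" for z
  proof -
    have "norm (g z - a) ^ 2 < norm (g z + a) ^ 2"
      using mult_pos_pos[OF a Reg[OF that]] unfolding cmod_power2
      by (simp add: power2_eq_square algebra_simps)
    then show ?thesis by (rule power2_less_imp_less) simp
  qed
  have nz: "g z + a \<noteq> 0" if "z \<in> unit_disc" for z using lt[OF that] by auto
  \<comment> \<open>The Cayley transform sends the right half-plane to the disc and \<open>a\<close> to \<open>0\<close>.\<close>
  have "norm ((\<lambda>z. (g z - a) / (g z + a)) z) \<le> norm z"
  proof (rule Schwarz_Lemma(1))
    show "(\<lambda>z. (g z - a) / (g z + a)) holomorphic_on ball 0 1"
      by (intro holomorphic_intros holg nz)
    show "norm ((g z - a) / (g z + a)) < 1" if "norm z < 1" for z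
      using lt[of z] nz[of z] that by (simp add: norm_divide divide_less_eq)
  qed (use z g0 in auto)
  then have "norm (g z - a) \<le> norm z * norm (g z + a)"
    using nz[OF z] by (simp add: norm_divide divide_le_eq)
  moreover have "norm (g z) \<le> norm (g z - a) + a"
    using norm_triangle_ineq[of "g z - a" "of_real a"] a by simp
  moreover have "norm z * norm (g z + a) \<le> norm z * (norm (g z) + a)"
    using norm_triangle_ineq[of "g z" "of_real a"] a by (intro mult_left_mono) auto
  ultimately show ?thesis unfolding g_def a_def by (simp add: algebra_simps)
qed

text \<open>
  Apply the strict version to \<open>f + \<delta>\<close> and let \<open>\<delta>\<close> decrease to \<open>0\<close>. The perturbation also takes
  care of functions with \<open>Re (f 0) = 0\<close>.
\<close>
lemma norm_le_of_Re_nonneg: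
  assumes holf: "f holomorphic_on unit_disc" and nonneg: "\<And>z. z \<in> unit_disc \<Longrightarrow> 0 \<le> Re (f z)"
    and z: "z \<in> unit_disc"
  shows "norm (f z - \<i> * Im (f 0)) * (1 - norm z) \<le> Re (f 0) * (1 + norm z)"
proof (rule tendsto_le[OF trivial_limit_at_right_real[of 0]])
  show "((\<lambda>\<delta>. norm (f z + of_real \<delta> - \<i> * Im (f 0)) * (1 - norm z)) \<longlongrightarrow>
      norm (f z - \<i> * Im (f 0)) * (1 - norm z)) (at_right 0)"
    by (rule tendsto_eq_intros refl | simp)+
  show "((\<lambda>\<delta>. (Re (f 0) + \<delta>) * (1 + norm z)) \<longlongrightarrow> Re (f 0) * (1 + norm z)) (at_right 0)"
    by (rule tendsto_eq_intros refl | simp)+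
  show "\<forall>\<^sub>F \<delta> in at_right 0. norm (f z + of_real \<delta> - \<i> * Im (f 0)) * (1 - norm z)
      \<le> (Re (f 0) + \<delta>) * (1 + norm z)"
    using eventually_at_right_less[of 0]
  proof eventually_elim
    case (elim \<delta>)
    have "(\<lambda>z. f z + of_real \<delta>) holomorphic_on unit_disc" by (intro holomorphic_intros holf)
    from norm_le_of_Re_pos[OF this _ z] nonneg elim show ?case by (simp add: add_nonneg_pos)
  qed
qed

lemma one_minus_cnj_mult_nonzero:
  assumes "norm a \<le> 1" "norm z < 1"
  shows "1 - cnj a * z \<noteq> 0"
proof
  assume "1 - cnj a * z = 0"
  then have "norm (cnj a * z) = 1" by (metis eq_iff_diff_eq_0 norm_one)
  moreover have "norm (cnj a * z) \<le> 1 * norm z" unfolding norm_mult complex_mod_cnj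
    by (rule mult_right_mono) (use assms in auto)
  ultimately show False using assms by simp
qed

lemma one_minus_norm_Moebius_sq:
  assumes "norm a < 1" "norm z < 1"
  shows "1 - (norm ((z - a) / (1 - cnj a * z)))\<^sup>2
    = (1 - (norm z)\<^sup>2) * (1 - (norm a)\<^sup>2) / (norm (1 - cnj a * z))\<^sup>2"
proof -
  have "norm (1 - cnj a * z) \<noteq> 0" using one_minus_cnj_mult_nonzero[of a z] assms by simp
  moreover have "(norm (1 - cnj a * z))\<^sup>2 - (norm (z - a))\<^sup>2 = (1 - (norm z)\<^sup>2) * (1 - (norm a)\<^sup>2)"
    by (simp add: cmod_power2) (simp add: power2_eq_square algebra_simps)
  ultimately show ?thesis
    by (simp add: norm_divide power_divide field_simps)
qed

text \<open>
  The invariant form of the previous estimate: move the base point from \<open>0\<close> to \<open>a\<close> by a disc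
  automorphism. The freedom to choose \<open>a\<close> is what the Julia--Wolff lemma below needs.
\<close>
lemma harnack_unit_disc:
  assumes holf: "f holomorphic_on unit_disc" and nonneg: "\<And>z. z \<in> unit_disc \<Longrightarrow> 0 \<le> Re (f z)"
    and z: "z \<in> unit_disc" and a: "a \<in> unit_disc"
  shows "norm (f z - \<i> * Im (f a))
    \<le> 4 * (norm (1 - cnj a * z))\<^sup>2 / ((1 - (norm z)\<^sup>2) * (1 - (norm a)\<^sup>2)) * Re (f a)"
proof -
  have za: "norm z < 1" "norm a < 1" "norm (- a) < 1" using z a by auto
  \<comment> \<open>\<open>\<psi>\<close> is the disc automorphism with \<open>\<psi> 0 = a\<close>, and \<open>\<psi> \<zeta> = z\<close>.\<close>
  define \<psi> where "\<psi> = Moebius_function 0 (- a)"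
  define \<zeta> where "\<zeta> = Moebius_function 0 a z"
  define r where "r = norm \<zeta>"
  have r: "0 \<le> r" "r < 1" using Moebius_function_norm_lt_1[OF za(2,1)] by (auto simp: r_def \<zeta>_def)
  have hol\<psi>: "\<psi> holomorphic_on unit_disc"
    unfolding \<psi>_def by (rule Moebius_function_holomorphic[OF za(3)])
  have \<psi>: "\<psi> w \<in> unit_disc" if "w \<in> unit_disc" for w
    using Moebius_function_norm_lt_1[OF za(3), of w] that by (simp add: \<psi>_def)
  have \<psi>0: "\<psi> 0 = a" by (simp add: \<psi>_def Moebius_function_of_zero)
  have \<psi>\<zeta>: "\<psi> \<zeta> = z" unfolding \<psi>_def \<zeta>_def
    by (rule Moebius_function_compose) (use za in auto)
  have hol: "(f \<circ> \<psi>) holomorphic_on unit_disc"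
    by (rule holomorphic_on_compose_gen[OF hol\<psi> holf]) (use \<psi> in auto)
  have *: "norm ((f \<circ> \<psi>) \<zeta> - \<i> * Im ((f \<circ> \<psi>) 0)) * (1 - norm \<zeta>) \<le> Re ((f \<circ> \<psi>) 0) * (1 + norm \<zeta>)"
    by (rule norm_le_of_Re_nonneg[OF hol]) (use \<psi> nonneg r in \<open>auto simp: r_def\<close>)
  have A: "0 \<le> Re (f a)" using nonneg a by simp
  define n where "n = norm (f z - \<i> * Im (f a))"
  have "n * (1 - r) \<le> Re (f a) * (1 + r)"
    using * by (simp add: \<psi>\<zeta> \<psi>0 n_def flip: r_def)
  \<comment> \<open>Multiplying by \<open>1 + r\<close> turns the factor \<open>(1 + r) / (1 - r)\<close> into \<open>(1 + r)\<^sup>2 / (1 - r\<^sup>2)\<close>,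
    whose numerator is at most \<open>4\<close> and whose denominator is explicit in \<open>a\<close> and \<open>z\<close>.\<close>
  then have "n * (1 - r) * (1 + r) \<le> Re (f a) * (1 + r) * (1 + r)"
    by (rule mult_right_mono) (use r in auto)
  then have "n * (1 - r\<^sup>2) \<le> Re (f a) * (1 + r)\<^sup>2"
    by (simp add: power2_eq_square algebra_simps)
  also have "\<dots> \<le> Re (f a) * 2\<^sup>2"
    using r A by (intro mult_left_mono power_mono) auto
  finally have "n * (1 - r\<^sup>2) \<le> 4 * Re (f a)" by simp
  moreover have "1 - r\<^sup>2 = (1 - (norm z)\<^sup>2) * (1 - (norm a)\<^sup>2) / (norm (1 - cnj a * z))\<^sup>2"
    using one_minus_norm_Moebius_sq[OF za(2,1)] by (simp add: r_def \<zeta>_def Moebius_function_simple)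
  moreover have "norm (1 - cnj a * z) > 0"
    using one_minus_cnj_mult_nonzero[of a z] za by simp
  moreover have "(1 - (norm z)\<^sup>2) * (1 - (norm a)\<^sup>2) > 0"
    using za by (simp add: power_less_one_iff abs_square_less_1)
  ultimately show ?thesis by (simp add: n_def field_simps)
qed

text \<open>
  All values on a compact disc are controlled by the value at \<open>0\<close>. For a Herglotz function this
  yields integrable majorants \<open>C * norm (p 0 t)\<close> that are uniform in the space variable.
\<close>
lemma norm_le_of_Re_nonneg_cball:
  assumes holf: "f holomorphic_on unit_disc" and nonneg: "\<And>z. z \<in> unit_disc \<Longrightarrow> 0 \<le> Re (f z)"
    and z: "norm z \<le> \<rho>" and \<rho>: "\<rho> < 1"
  shows "norm (f z) \<le> (1 + 4 / (1 - \<rho>\<^sup>2)) * norm (f 0)"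
proof -
  have z': "z \<in> unit_disc" "0 \<le> \<rho>" using z \<rho> norm_ge_zero[of z] by (auto simp del: norm_ge_zero)
  have "norm (f z - \<i> * Im (f 0)) \<le> 4 / (1 - (norm z)\<^sup>2) * Re (f 0)"
    using harnack_unit_disc[OF holf nonneg z'(1), of 0] by simp
  also have "\<dots> \<le> 4 / (1 - \<rho>\<^sup>2) * norm (f 0)"
    using nonneg[of 0] complex_Re_le_cmod[of "f 0"] z z' \<rho>
    by (intro mult_mono divide_left_mono)
       (auto simp: abs_square_le_1 abs_square_less_1 intro!: power_mono mult_pos_pos)
  finally have "norm (f z - \<i> * Im (f 0)) \<le> 4 / (1 - \<rho>\<^sup>2) * norm (f 0)" .
  moreover have "norm (\<i> * Im (f 0)) \<le> norm (f 0)"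
    using abs_Im_le_cmod[of "f 0"] by (simp add: norm_mult)
  moreover have "norm (f z) \<le> norm (f z - \<i> * Im (f 0)) + norm (\<i> * Im (f 0))"
    using norm_triangle_ineq[of "f z - \<i> * Im (f 0)" "\<i> * Im (f 0)"] by simp
  ultimately show ?thesis by (simp add: algebra_simps)
qed

section \<open>The half-plane coordinate and the Julia--Wolff lemma\<close>

text \<open>
  For \<open>norm \<tau> = 1\<close> this is the Cayley transform that sends \<open>\<tau>\<close> to infinity and the disc onto the
  right half-plane. Its real part is the Poisson kernel with pole \<open>\<tau>\<close>.
\<close>
definition half_plane_map :: "complex \<Rightarrow> complex \<Rightarrow> complex" where
  "half_plane_map \<tau> z = (\<tau> + z) / (\<tau> - z)"

lemma half_plane_map_holomorphic:
  assumes "norm \<tau> = 1"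
  shows "half_plane_map \<tau> holomorphic_on unit_disc"
  unfolding half_plane_map_def using assms by (intro holomorphic_intros) auto

lemma Re_half_plane_map:
  assumes "norm \<tau> = 1"
  shows "Re (half_plane_map \<tau> z) = (1 - (norm z)\<^sup>2) / (norm (\<tau> - z))\<^sup>2"
proof -
  have "(Re \<tau>)\<^sup>2 + (Im \<tau>)\<^sup>2 = 1" using assms by (simp add: cmod_def)
  then show ?thesis
    by (simp add: half_plane_map_def Re_divide cmod_power2)
       (simp add: power2_eq_square algebra_simps)
qed

lemma Re_half_plane_map_pos:
  assumes "norm \<tau> = 1" "z \<in> unit_disc"
  shows "0 < Re (half_plane_map \<tau> z)"
proof -
  have "\<tau> \<noteq> z" "norm z < 1" using assms by auto
  then show ?thesis using assms by (simp add: Re_half_plane_map abs_square_less_1)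
qed

lemma half_plane_map_plus_one:
  assumes "\<tau> \<noteq> z"
  shows "half_plane_map \<tau> z + 1 = 2 * \<tau> / (\<tau> - z)"
  using assms by (simp add: half_plane_map_def field_simps)

lemma norm_half_plane_map_plus_one:
  assumes "norm \<tau> = 1" "z \<in> unit_disc"
  shows "norm (half_plane_map \<tau> z + 1) = 2 / norm (\<tau> - z)"
proof -
  have "\<tau> \<noteq> z" using assms by auto
  then show ?thesis using assms by (simp add: half_plane_map_plus_one norm_divide norm_mult)
qed

text \<open>
  In a sector of the half-plane \<open>1 / (1 - (norm z)\<^sup>2)\<close>, which governs the Harnack inequality
  with base point \<open>0\<close>, grows only linearly in the half-plane coordinate, since it equals
  \<open>(norm (W + 1))\<^sup>2 / (4 * Re W)\<close>.
\<close>
lemma poisson_kernel_sector_bound: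
  assumes \<tau>: "norm \<tau> = 1" and z: "z \<in> unit_disc"
    and sector: "norm (half_plane_map \<tau> z) \<le> M * Re (half_plane_map \<tau> z)"
    and large: "1 \<le> norm (half_plane_map \<tau> z)"
  shows "4 / (1 - (norm z)\<^sup>2) \<le> 4 * M * norm (half_plane_map \<tau> z)"
proof -
  define W where "W = half_plane_map \<tau> z"
  have ne: "\<tau> \<noteq> z" "norm z < 1" using \<tau> z by auto
  have ReW: "Re W > 0" using Re_half_plane_map_pos[OF \<tau> z] by (simp add: W_def)
  have "4 / (1 - (norm z)\<^sup>2) = (norm (W + 1))\<^sup>2 / Re W"
    using ne unfolding W_def norm_half_plane_map_plus_one[OF \<tau> z] Re_half_plane_map[OF \<tau>]
    by (simp add: power_divide field_simps)
  also have "\<dots> \<le> (2 * norm W)\<^sup>2 / Re W"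
    using large norm_triangle_ineq[of W 1] ReW
    by (intro divide_right_mono power_mono) (auto simp: W_def)
  also have "\<dots> = 4 * norm W * norm W / Re W" by (simp add: power2_eq_square)
  also have "\<dots> \<le> 4 * norm W * (M * Re W) / Re W"
    using sector ReW by (intro divide_right_mono mult_left_mono) (auto simp: W_def)
  also have "\<dots> = 4 * M * norm W" using ReW by simp
  finally show ?thesis by (simp add: W_def)
qed

text \<open>
  Functions with nonnegative real part grow at most linearly in the half-plane coordinate as
  long as this coordinate stays in a sector.
\<close>
lemma norm_le_in_sector:
  assumes \<tau>: "norm \<tau> = 1" and holf: "f holomorphic_on unit_disc"
    and nonneg: "\<And>z. z \<in> unit_disc \<Longrightarrow> 0 \<le> Re (f z)" and z: "z \<in> unit_disc"
    and sector: "norm (half_plane_map \<tau> z) \<le> M * Re (half_plane_map \<tau> z)"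
    and large: "1 \<le> norm (half_plane_map \<tau> z)"
  shows "norm (f z) \<le> (1 + 4 * M) * norm (f 0) * norm (half_plane_map \<tau> z)"
proof -
  define W where "W = half_plane_map \<tau> z"
  have "norm (f z - \<i> * Im (f 0)) \<le> 4 / (1 - (norm z)\<^sup>2) * Re (f 0)"
    using harnack_unit_disc[OF holf nonneg z, of 0] by simp
  also have "\<dots> \<le> (4 * M * norm W) * norm (f 0)"
  proof (rule mult_mono)
    show le: "4 / (1 - (norm z)\<^sup>2) \<le> 4 * M * norm W"
      using poisson_kernel_sector_bound[OF \<tau> z sector large] by (simp add: W_def)
    have "0 \<le> 4 / (1 - (norm z)\<^sup>2)" using z by (simp add: abs_square_le_1)
    then show "0 \<le> 4 * M * norm W" using le by linarith
  qed (use nonneg[of 0] complex_Re_le_cmod[of "f 0"] in auto)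
  finally have "norm (f z - \<i> * Im (f 0)) \<le> (4 * M * norm W) * norm (f 0)" .
  moreover have "norm (\<i> * Im (f 0)) \<le> norm (f 0) * norm W"
    using mult_mono[of "\<bar>Im (f 0)\<bar>" "norm (f 0)" 1 "norm W"] abs_Im_le_cmod[of "f 0"] large
    by (simp add: norm_mult W_def)
  moreover have "norm (f z) \<le> norm (f z - \<i> * Im (f 0)) + norm (\<i> * Im (f 0))"
    using norm_triangle_ineq[of "f z - \<i> * Im (f 0)" "\<i> * Im (f 0)"] by simp
  ultimately show ?thesis by (simp add: W_def algebra_simps)
qed

text \<open>
  For holomorphic \<open>f\<close> with nonnegative real part this is the slope at infinity of Julia, Wolff
  and Caratheodory, taken in the half-plane coordinate; in terms of the Herglotz representation
  of \<open>f\<close> it is the mass of the representing measure at \<open>\<tau>\<close>.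
\<close>
definition angular_slope :: "complex \<Rightarrow> (complex \<Rightarrow> complex) \<Rightarrow> real" where
  "angular_slope \<tau> f = (INF z\<in>unit_disc. Re (f z) / Re (half_plane_map \<tau> z))"

text \<open>
  The Julia--Wolff lemma: after subtracting its slope times \<open>half_plane_map \<tau>\<close>, a function with
  nonnegative real part is \<open>o(norm W)\<close> inside every sector. The infimum is nearly attained at
  some point \<open>a\<close>, and the Harnack inequality with base point \<open>a\<close> carries the smallness there to
  all points near \<open>\<tau>\<close> in the sector.
\<close>
lemma
  assumes \<tau>: "norm \<tau> = 1" and holp: "p holomorphic_on unit_disc"
    and nonneg: "\<And>z. z \<in> unit_disc \<Longrightarrow> 0 \<le> Re (p z)"
  shows angular_slope_nonneg: "0 \<le> angular_slope \<tau> p"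
    and angular_slope_le: "\<And>z. z \<in> unit_disc \<Longrightarrow> angular_slope \<tau> p * Re (half_plane_map \<tau> z) \<le> Re (p z)"
    and angular_slope_asymptotic:
      "0 < \<epsilon> \<Longrightarrow> \<exists>R. \<forall>z\<in>unit_disc. norm (half_plane_map \<tau> z) \<le> M * Re (half_plane_map \<tau> z) \<longrightarrow>
         R \<le> norm (half_plane_map \<tau> z) \<longrightarrow>
         norm (p z - angular_slope \<tau> p * half_plane_map \<tau> z) \<le> \<epsilon> * norm (half_plane_map \<tau> z)"
proof -
  let ?W = "half_plane_map \<tau>"
  define c where "c = angular_slope \<tau> p"
  note c_def = c_def[unfolded angular_slope_def]
  have pos: "Re (?W z) > 0" if "z \<in> unit_disc" for z using Re_half_plane_map_pos[OF \<tau> that] .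
  have bdd: "bdd_below ((\<lambda>z. Re (p z) / Re (?W z)) ` unit_disc)"
    by (rule bdd_belowI[of _ 0]) (use nonneg pos in \<open>auto intro!: divide_nonneg_pos\<close>)
  have c0: "c \<ge> 0" unfolding c_def
    by (rule cINF_greatest) (use nonneg pos in \<open>auto intro!: divide_nonneg_pos\<close>)
  have cle: "c * Re (?W z) \<le> Re (p z)" if "z \<in> unit_disc" for z
    using cINF_lower[OF bdd that] pos[OF that] by (simp add: c_def field_simps)
  \<comment> \<open>Subtracting the slope times \<open>?W\<close> leaves a function that still has nonnegative real part but slope \<open>0\<close>.\<close>
  define q where "q = (\<lambda>z. p z - c * ?W z)"
  have holq: "q holomorphic_on unit_disc"
    unfolding q_def by (intro holomorphic_intros holp half_plane_map_holomorphic \<tau>)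
  have q0: "0 \<le> Re (q z)" if "z \<in> unit_disc" for z using cle[OF that] by (simp add: q_def)
  show "0 \<le> angular_slope \<tau> p"
    and "\<And>z. z \<in> unit_disc \<Longrightarrow> angular_slope \<tau> p * Re (?W z) \<le> Re (p z)"
    using c0 cle by (simp_all add: c_def angular_slope_def)
  have "\<exists>R. \<forall>z\<in>unit_disc. norm (?W z) \<le> M * Re (?W z) \<longrightarrow> R \<le> norm (?W z) \<longrightarrow>
       norm (p z - c * ?W z) \<le> \<epsilon> * norm (?W z)" if \<epsilon>: "0 < \<epsilon>"
    proof -
      \<comment> \<open>The Harnack inequality below loses a factor \<open>16 M\<close>; the rest of the budget \<open>\<epsilon> / 2\<close> is for
        the imaginary part at \<open>a\<close>.\<close>
      define \<epsilon>' where "\<epsilon>' = \<epsilon> / (32 * (\<bar>M\<bar> + 1))"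
      have \<epsilon>': "\<epsilon>' > 0" using \<epsilon> by (simp add: \<epsilon>'_def)
      have "\<exists>a\<in>unit_disc. Re (p a) / Re (?W a) < c + \<epsilon>'"
        using cINF_less_iff[OF _ bdd, of "c + \<epsilon>'"] \<epsilon>' by (auto simp: c_def)
      \<comment> \<open>A base point \<open>a\<close> at which the ratio of real parts almost attains its infimum.\<close>
      then obtain a where a: "a \<in> unit_disc" and "Re (p a) / Re (?W a) < c + \<epsilon>'" by blast
      then have qa: "Re (q a) \<le> \<epsilon>' * Re (?W a)"
        using pos[OF a] by (simp add: q_def field_simps)
      define \<eta> where "\<eta> = norm (\<tau> - a)"
      have \<eta>: "\<eta> > 0" using a \<tau> by (auto simp: \<eta>_def)
      \<comment> \<open>The entry \<open>2 / \<eta> + 1\<close> makes \<open>z\<close> as close to \<open>\<tau>\<close> as \<open>a\<close> is, the last one absorbs \<open>Im (q a)\<close>.\<close>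
      define R where "R = max 1 (max (2 / \<eta> + 1) (2 * \<bar>Im (q a)\<bar> / \<epsilon>))"
      show ?thesis
      proof (intro exI[of _ R] ballI impI)
        fix z assume z: "z \<in> unit_disc" and sector: "norm (?W z) \<le> M * Re (?W z)" and R: "R \<le> norm (?W z)"
        define w where "w = norm (?W z)"
        have w: "w \<ge> 1" "w \<ge> 2 / \<eta> + 1" "w \<ge> 2 * \<bar>Im (q a)\<bar> / \<epsilon>" using R by (auto simp: R_def w_def)
        have ne: "\<tau> \<noteq> z" "norm z < 1" "norm a < 1" using \<tau> z a by auto
        have M: "M > 0"
          using sector pos[OF z] w(1) by (smt (verit) mult_nonpos_nonneg w_def)
        have near: "norm (\<tau> - z) \<le> \<eta>"
        proof -
          have "2 / \<eta> \<le> w - 1" using w by simp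
          also have "w - 1 \<le> norm (?W z + 1)"
            using norm_triangle_ineq2[of "?W z" "- 1"] by (simp add: w_def)
          also have "\<dots> = 2 / norm (\<tau> - z)" by (rule norm_half_plane_map_plus_one[OF \<tau> z])
          finally show ?thesis using \<eta> ne by (simp add: field_simps)
        qed
        have "norm (1 - cnj a * z) \<le> norm (1 - cnj a * \<tau>) + norm (cnj a * (\<tau> - z))"
          using norm_triangle_ineq[of "1 - cnj a * \<tau>" "cnj a * (\<tau> - z)"] by (simp add: algebra_simps)
        also have "norm (1 - cnj a * \<tau>) = \<eta>"
        proof -
          have "1 = cnj \<tau> * \<tau>" using \<tau> by (simp add: complex_norm_square[symmetric] mult.commute)
          then have "1 - cnj a * \<tau> = cnj (\<tau> - a) * \<tau>" by (simp add: algebra_simps)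
          then have "norm (1 - cnj a * \<tau>) = norm (cnj (\<tau> - a)) * norm \<tau>" by (simp only: norm_mult)
          then show ?thesis using \<tau> by (simp only: complex_mod_cnj \<eta>_def)
        qed
        also have "norm (cnj a * (\<tau> - z)) \<le> 1 * \<eta>"
          unfolding norm_mult using near ne by (intro mult_mono) auto
        finally have na: "norm (1 - cnj a * z) \<le> 2 * \<eta>" by simp
        have "norm (q z - \<i> * Im (q a))
            \<le> 4 * (norm (1 - cnj a * z))\<^sup>2 / ((1 - (norm z)\<^sup>2) * (1 - (norm a)\<^sup>2)) * Re (q a)"
          by (rule harnack_unit_disc[OF holq q0 z a])
        also have "\<dots> \<le> 4 * (2 * \<eta>)\<^sup>2 / ((1 - (norm z)\<^sup>2) * (1 - (norm a)\<^sup>2)) * (\<epsilon>' * Re (?W a))"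
          using na qa q0[OF a] ne \<epsilon>' pos[OF a]
          by (intro mult_mono divide_right_mono mult_left_mono power_mono)
             (auto simp: abs_square_less_1 less_imp_le)
        also have "\<dots> = 4 * \<epsilon>' * (4 / (1 - (norm z)\<^sup>2))"
        proof -
          have *: "4 * (2 * \<eta>)\<^sup>2 / (Z * A) * (\<epsilon>' * (A / \<eta>\<^sup>2)) = 4 * \<epsilon>' * (4 / Z)" if "A > 0" "Z > 0" for A Z :: real
            using that \<eta> by (simp add: field_simps)
          show ?thesis unfolding Re_half_plane_map[OF \<tau>] \<eta>_def[symmetric]
            by (rule *) (use ne in \<open>simp_all add: abs_square_less_1\<close>)
        qed
        also have "\<dots> \<le> 4 * \<epsilon>' * (4 * M * w)"
          unfolding w_def using \<epsilon>' w(1)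
          by (intro mult_left_mono poisson_kernel_sector_bound[OF \<tau> z sector]) (auto simp: w_def)
        also have "\<dots> = (16 * M / (32 * (\<bar>M\<bar> + 1))) * \<epsilon> * w" by (simp add: \<epsilon>'_def)
        also have "\<dots> \<le> (1 / 2) * \<epsilon> * w"
          using M \<epsilon> w(1) by (intro mult_right_mono) (auto simp: field_simps)
        finally have 1: "norm (q z - \<i> * Im (q a)) \<le> \<epsilon> * w / 2" by simp
        have 2: "norm (\<i> * Im (q a)) \<le> \<epsilon> * w / 2"
          using w(3) \<epsilon> by (simp add: norm_mult field_simps)
        have "norm (q z) \<le> \<epsilon> * w"
          using norm_triangle_ineq[of "q z - \<i> * Im (q a)" "\<i> * Im (q a)"] 1 2 by simp
        then show "norm (p z - c * ?W z) \<le> \<epsilon> * norm (?W z)" by (simp add: q_def w_def)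
      qed
    qed
  then show "0 < \<epsilon> \<Longrightarrow> \<exists>R. \<forall>z\<in>unit_disc. norm (?W z) \<le> M * Re (?W z) \<longrightarrow> R \<le> norm (?W z) \<longrightarrow>
       norm (p z - angular_slope \<tau> p * ?W z) \<le> \<epsilon> * norm (?W z)"
    by (simp add: c_def angular_slope_def)
qed

section \<open>Angular limits\<close>

lemma tendsto_at_angular_iff:
  "(f \<longlongrightarrow> l) (at_angular \<sigma>) \<longleftrightarrow> (\<forall>M>1. (f \<longlongrightarrow> l) (at \<sigma> within stolz_region \<sigma> M))"
  unfolding at_angular_def filterlim_def filtermap_SUP by (auto simp: SUP_le_iff)

lemma stolz_region_subset: "stolz_region \<sigma> M \<subseteq> unit_disc"
  by (auto simp: stolz_region_def)

text \<open>
  Non-tangential approach in the disc is approach to infinity within a sector in the half-plane,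
  with the same aperture constant.
\<close>
lemma stolz_region_sector:
  assumes \<tau>: "norm \<tau> = 1" and z: "z \<in> stolz_region \<tau> M"
  shows "norm (half_plane_map \<tau> z) \<le> M * Re (half_plane_map \<tau> z)"
proof -
  have z': "norm z < 1" "norm (\<tau> - z) < M * (1 - norm z)" "\<tau> \<noteq> z"
    using z \<tau> by (auto simp: stolz_region_def norm_minus_commute)
  define \<delta> where "\<delta> = norm (\<tau> - z)"
  have \<delta>: "\<delta> > 0" using z' by (simp add: \<delta>_def)
  have "norm (half_plane_map \<tau> z) = norm (\<tau> + z) * \<delta> / \<delta>\<^sup>2"
    using \<delta> by (simp add: half_plane_map_def norm_divide \<delta>_def power2_eq_square)
  also have "\<dots> \<le> (1 + norm z) * (M * (1 - norm z)) / \<delta>\<^sup>2"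
    using norm_triangle_ineq[of \<tau> z] \<tau> z' \<delta>
    by (intro divide_right_mono mult_mono) (auto simp: \<delta>_def)
  also have "\<dots> = M * Re (half_plane_map \<tau> z)"
    by (simp add: Re_half_plane_map[OF \<tau>] \<delta>_def power2_eq_square algebra_simps)
  finally show ?thesis .
qed

lemma half_plane_map_filterlim:
  assumes \<sigma>: "norm \<sigma> = 1" and Y: "\<And>n. Y n \<in> unit_disc" "Y \<longlonglongrightarrow> \<sigma>"
  shows "filterlim (\<lambda>n. norm (half_plane_map \<sigma> (Y n))) at_top sequentially"
proof -
  have "\<sigma> \<noteq> Y n" for n using Y(1)[of n] \<sigma> by auto
  then have "\<forall>\<^sub>F n in sequentially. norm (\<sigma> - Y n) > 0" by simp
  moreover have "(\<lambda>n. norm (\<sigma> - Y n)) \<longlonglongrightarrow> norm (\<sigma> - \<sigma>)" by (intro tendsto_intros Y)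
  ultimately have "filterlim (\<lambda>n. norm (\<sigma> - Y n)) (at_right 0) sequentially"
    by (auto simp: filterlim_at eventually_mono)
  then have "filterlim (\<lambda>n. 2 / norm (\<sigma> - Y n)) at_top sequentially"
    unfolding divide_inverse
    by (intro filterlim_tendsto_pos_mult_at_top[OF tendsto_const] filterlim_compose[OF filterlim_inverse_at_top_right]) simp_all
  then have "filterlim (\<lambda>n. - 1 + 2 / norm (\<sigma> - Y n)) at_top sequentially"
    by (rule filterlim_tendsto_add_at_top[OF tendsto_const])
  then show ?thesis
  proof (rule filterlim_at_top_mono, intro always_eventually allI)
    fix n
    show "- 1 + 2 / norm (\<sigma> - Y n) \<le> norm (half_plane_map \<sigma> (Y n))"
      using norm_triangle_ineq[of "half_plane_map \<sigma> (Y n)" 1] norm_half_plane_map_plus_one[OF \<sigma> Y(1)[of n]]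
      by simp
  qed
qed

text \<open>
  Together with the formula for \<open>Re (half_plane_map \<tau> z)\<close> this is the angular limit in the
  integral formula for a boundary fixed point.
\<close>
lemma angular_slope_limit:
  assumes \<tau>: "norm \<tau> = 1" and holp: "p holomorphic_on unit_disc"
    and nonneg: "\<And>z. z \<in> unit_disc \<Longrightarrow> 0 \<le> Re (p z)"
  shows "((\<lambda>z. Re (p z) / Re (half_plane_map \<tau> z)) \<longlongrightarrow> angular_slope \<tau> p) (at_angular \<tau>)"
  unfolding tendsto_at_angular_iff tendsto_at_iff_sequentially
proof (intro allI impI)
  fix M :: real and Y assume "M > 1" and Y: "\<forall>i. Y i \<in> stolz_region \<tau> M - {\<tau>}" "Y \<longlonglongrightarrow> \<tau>"
  have disc: "Y n \<in> unit_disc" for n using Y(1) stolz_region_subset by blast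
  define c where "c = angular_slope \<tau> p"
  define W where "W = half_plane_map \<tau>"
  have "(\<lambda>n. Re (p (Y n)) / Re (W (Y n))) \<longlonglongrightarrow> c"
  proof (rule LIMSEQ_I)
    fix \<epsilon> :: real assume \<epsilon>: "\<epsilon> > 0"
    define \<epsilon>' where "\<epsilon>' = \<epsilon> / (2 * M)"
    have \<epsilon>': "\<epsilon>' > 0" using \<epsilon> \<open>M > 1\<close> by (simp add: \<epsilon>'_def)
    from angular_slope_asymptotic[OF \<tau> holp nonneg this]
    obtain R where R: "\<And>z. \<lbrakk>z \<in> unit_disc; norm (W z) \<le> M * Re (W z); R \<le> norm (W z)\<rbrakk> \<Longrightarrow>
       norm (p z - c * W z) \<le> \<epsilon>' * norm (W z)"
      unfolding W_def c_def by meson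
    obtain n0 where n0: "\<And>n. n \<ge> n0 \<Longrightarrow> R \<le> norm (W (Y n))"
      using half_plane_map_filterlim[OF \<tau> disc Y(2)]
      unfolding filterlim_at_top eventually_sequentially W_def by blast
    show "\<exists>n0. \<forall>n\<ge>n0. norm (Re (p (Y n)) / Re (W (Y n)) - c) < \<epsilon>"
    proof (intro exI[of _ n0] allI impI)
      fix n assume n: "n \<ge> n0"
      define z where "z = Y n"
      have pos: "Re (W z) > 0" using Re_half_plane_map_pos[OF \<tau> disc[of n]] by (simp add: z_def W_def)
      have sector: "norm (W z) \<le> M * Re (W z)"
        using stolz_region_sector[OF \<tau>, of z M] Y(1) by (simp add: z_def W_def)
      have "\<bar>Re (p z) - c * Re (W z)\<bar> \<le> norm (p z - c * W z)"
        using abs_Re_le_cmod[of "p z - c * W z"] by simp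
      also have "\<dots> \<le> \<epsilon>' * norm (W z)" using R[OF _ sector] disc n0[OF n] by (simp add: z_def)
      also have "\<dots> \<le> \<epsilon>' * (M * Re (W z))" using sector \<epsilon>' by (intro mult_left_mono) auto
      also have "\<dots> = \<epsilon> / 2 * Re (W z)" using \<open>M > 1\<close> by (simp add: \<epsilon>'_def)
      finally have "\<bar>Re (p z) - c * Re (W z)\<bar> / Re (W z) \<le> \<epsilon> / 2"
        using pos by (simp add: field_simps)
      moreover have "Re (p z) / Re (W z) - c = (Re (p z) - c * Re (W z)) / Re (W z)"
        using pos by (simp add: field_simps)
      ultimately have "\<bar>Re (p z) / Re (W z) - c\<bar> \<le> \<epsilon> / 2" using pos by (simp add: abs_divide)
      then show "norm (Re (p (Y n)) / Re (W (Y n)) - c) < \<epsilon>" using \<epsilon> by (simp add: z_def)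
    qed
  qed
  then show "((\<lambda>z. Re (p z) / Re (half_plane_map \<tau> z)) \<circ> Y) \<longlonglongrightarrow> angular_slope \<tau> p"
    by (simp add: o_def W_def c_def)
qed

text \<open>
  Radial approach stays in every Stolz region, so angular limits are unique.
\<close>
lemma at_within_stolz_region_nontrivial:
  assumes \<sigma>: "norm \<sigma> = 1"
  shows "at \<sigma> within stolz_region \<sigma> 2 \<noteq> bot"
proof -
  define Z where "Z = (\<lambda>n. of_real (1 - 1 / real (Suc n)) * \<sigma>)"
  have "Z n \<in> stolz_region \<sigma> 2 - {\<sigma>}" for n
  proof -
    define a where "a = 1 / real (Suc n)"
    have a: "0 < a" "a \<le> 1" by (auto simp: a_def)
    have "Z n - \<sigma> = of_real (- a) * \<sigma>" by (simp add: Z_def a_def algebra_simps)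
    then have "norm (Z n - \<sigma>) = a" using \<sigma> a by (simp add: norm_mult)
    moreover have "norm (Z n) = \<bar>1 - a\<bar>" using \<sigma> unfolding Z_def a_def norm_mult norm_of_real by simp
    ultimately show ?thesis using a by (auto simp: stolz_region_def)
  qed
  moreover have "Z \<longlonglongrightarrow> \<sigma>"
  proof -
    have "Z \<longlonglongrightarrow> of_real (1 - 0) * \<sigma>"
      unfolding Z_def by (intro tendsto_intros LIMSEQ_Suc[OF lim_1_over_n])
    then show ?thesis by simp
  qed
  ultimately have "\<sigma> islimpt stolz_region \<sigma> 2"
    unfolding islimpt_sequential by blast
  then show ?thesis by (simp add: trivial_limit_within)
qed

section \<open>Uniqueness of the spectral function\<close>

lemma has_derivative_at_fixed_point_unique:
  assumes \<sigma>: "\<sigma> \<in> cball 0 1"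
    and D: "has_derivative_at_fixed_point f D \<sigma>" and D': "has_derivative_at_fixed_point f D' \<sigma>"
  shows "D = D'"
proof (cases "\<sigma> \<in> unit_disc")
  case True
  then show ?thesis using D D' DERIV_unique unfolding has_derivative_at_fixed_point_def by auto
next
  case False
  then have bd: "norm \<sigma> = 1" using \<sigma> by simp
  have "((\<lambda>z. (f z - \<sigma>) / (z - \<sigma>)) \<longlongrightarrow> D) (at \<sigma> within stolz_region \<sigma> 2)"
    "((\<lambda>z. (f z - \<sigma>) / (z - \<sigma>)) \<longlongrightarrow> D') (at \<sigma> within stolz_region \<sigma> 2)"
    using D D' False unfolding has_derivative_at_fixed_point_def has_angular_derivative_def
      tendsto_at_angular_iff by auto
  then show ?thesis by (rule tendsto_unique[OF at_within_stolz_region_nontrivial[OF bd]])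
qed

lemma spectral_functionD:
  assumes "spectral_function d \<phi> \<sigma> l" "0 \<le> s" "s \<le> t"
  shows "has_derivative_at_fixed_point (\<phi> s t) (exp (l s - l t)) \<sigma>"
  using assms by (simp add: spectral_function_def)

text \<open>
  The exponentials of two spectral functions agree, so their difference takes values in a
  discrete set; it is continuous and vanishes at \<open>0\<close>.
\<close>
lemma spectral_function_unique:
  assumes \<sigma>: "\<sigma> \<in> cball 0 1"
    and l: "spectral_function d \<phi> \<sigma> l" and m: "spectral_function d \<phi> \<sigma> m" and "0 \<le> t"
  shows "m t = l t"
proof -
  define f where "f = (\<lambda>t. m t - l t)"
  have exp_f: "exp (f r) = 1" if "0 \<le> r" for r
  proof -
    have "exp (m 0 - m r) = exp (l 0 - l r)"
      by (rule has_derivative_at_fixed_point_unique[OF \<sigma> spectral_functionD[OF m] spectral_functionD[OF l]])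
         (use that in auto)
    then show ?thesis using l m unfolding spectral_function_def f_def by (simp add: exp_diff exp_minus)
  qed
  have "f constant_on {0..t + 1}"
  proof (rule continuous_discrete_range_constant)
    show "continuous_on {0..t + 1} f"
      unfolding f_def using l m \<open>0 \<le> t\<close> unfolding spectral_function_def locally_absolutely_continuous_def
      by (intro continuous_intros absolutely_continuous_on_imp_continuous_on) auto
    fix x assume x: "x \<in> {0..t + 1}"
    \<comment> \<open>All values of \<open>f\<close> lie in \<open>2 \<pi> \<i> \<int>\<close>.\<close>
    show "\<exists>e>0. \<forall>y. y \<in> {0..t + 1} \<and> f y \<noteq> f x \<longrightarrow> e \<le> norm (f y - f x)"
    proof (intro exI[of _ "2 * pi"] conjI allI impI)
      fix y assume y: "y \<in> {0..t + 1} \<and> f y \<noteq> f x"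
      obtain i j :: int where ij: "Im (f x) = of_int (2 * i) * pi" "Im (f y) = of_int (2 * j) * pi"
        and Re: "Re (f x) = 0" "Re (f y) = 0"
        using exp_f[of x] exp_f[of y] x y unfolding exp_eq_1 by auto
      then have "i \<noteq> j" using y by (auto simp: complex_eq_iff)
      then have "1 \<le> \<bar>real_of_int (j - i)\<bar>" by linarith
      have "2 * pi * 1 \<le> 2 * pi * \<bar>real_of_int (j - i)\<bar>"
        using \<open>1 \<le> \<bar>real_of_int (j - i)\<bar>\<close> by (intro mult_left_mono) auto
      also have "\<dots> = \<bar>2 * pi * real_of_int (j - i)\<bar>" by (simp add: abs_mult)
      also have "2 * pi * real_of_int (j - i) = Im (f y - f x)" by (simp add: ij algebra_simps)
      also have "\<bar>Im (f y - f x)\<bar> \<le> norm (f y - f x)" by (rule abs_Im_le_cmod)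
      finally show "2 * pi \<le> norm (f y - f x)" by simp
    qed simp
  qed simp
  then have "f t = f 0" using \<open>0 \<le> t\<close> unfolding constant_on_def by auto
  moreover have "f 0 = 0" using l m unfolding spectral_function_def f_def by simp
  ultimately show ?thesis by (simp add: f_def)
qed

section \<open>Trajectories of an evolution family with constant \<open>\<tau>\<close>\<close>

text \<open>
  The data of the theorem with the function \<open>\<tau>\<close> already replaced by its constant value \<open>\<sigma>\<close>.
\<close>
locale evolution_with_constant_tau =
  fixes d :: ennreal and \<phi> :: "real \<Rightarrow> real \<Rightarrow> complex \<Rightarrow> complex"
    and p :: "complex \<Rightarrow> real \<Rightarrow> complex" and \<sigma> :: complex
  assumes d_ge_1: "1 \<le> d"
    and evolution: "evolution_family d \<phi>"
    and herglotz: "herglotz_function d p"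
    and \<sigma>: "\<sigma> \<in> cball 0 1"
    and ode: "\<And>z s. \<lbrakk>z \<in> unit_disc; 0 \<le> s\<rbrakk> \<Longrightarrow> AE t in lebesgue. s \<le> t \<longrightarrow>
        ((\<lambda>r. \<phi> s r z) has_vector_derivative
           (\<phi> s t z - \<sigma>) * (cnj \<sigma> * \<phi> s t z - 1) * p (\<phi> s t z) t) (at t within {s..})"

context evolution_with_constant_tau
begin

lemma trajectory_in_disc:
  assumes "0 \<le> s" "s \<le> t" "z \<in> unit_disc"
  shows "\<phi> s t z \<in> unit_disc"
  using evolution[unfolded evolution_family_def, THEN conjunct1] assms by blast

lemma trajectory_holomorphic:
  assumes "0 \<le> s" "s \<le> t"
  shows "\<phi> s t holomorphic_on unit_disc"
  using evolution[unfolded evolution_family_def, THEN conjunct1] assms by blast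

lemma trajectory_initial:
  assumes "0 \<le> s" "z \<in> unit_disc"
  shows "\<phi> s s z = z"
  using evolution[unfolded evolution_family_def, THEN conjunct2, THEN conjunct1] assms by blast

lemma trajectory_dominated_increments:
  assumes s: "0 \<le> s" "s \<le> t" and z: "z \<in> unit_disc"
  shows "dominated_increments s t (\<lambda>r. \<phi> s r z)"
proof -
  have "t + 1 > 0" using s by simp
  then obtain k :: "real \<Rightarrow> real" where k: "L_on d {0..t + 1} k"
    and inc: "\<And>s u v. \<lbrakk>0 \<le> s; s \<le> u; u \<le> v; v \<le> t + 1\<rbrakk> \<Longrightarrow>
           norm (\<phi> s u z - \<phi> s v z) \<le> (LINT \<xi>:{u..v}|lebesgue. k \<xi>)"
    using evolution[unfolded evolution_family_def, THEN conjunct2, THEN conjunct2, THEN conjunct2] z by blast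
  have k_int: "k absolutely_integrable_on {u..v}" if "0 \<le> u" "v \<le> t + 1" for u v
    using absolutely_integrable_on_subinterval[OF L_on_imp_absolutely_integrable[OF k d_ge_1]] that by auto
  show ?thesis
    unfolding dominated_increments_def
  proof (intro exI conjI allI impI)
    show "k integrable_on {s..t}"
      using k_int[of s t] s by (auto intro: set_lebesgue_integral_eq_integral(1))
    fix u v assume uv: "s \<le> u" "u \<le> v" "v \<le> t"
    then show "norm (\<phi> s v z - \<phi> s u z) \<le> integral {u..v} k"
      using inc[of s u v] s set_lebesgue_integral_eq_integral(2)[OF k_int[of u v]]
      by (simp add: norm_minus_commute)
  qed
qed

lemma trajectory_norm_le:
  assumes s: "0 \<le> s" "s \<le> t" and z: "z \<in> unit_disc"
  obtains \<rho> where "\<rho> < 1" "\<And>r. r \<in> {s..t} \<Longrightarrow> norm (\<phi> s r z) \<le> \<rho>"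
proof -
  have "continuous_on {s..t} (\<lambda>r. norm (\<phi> s r z))"
    by (intro continuous_intros dominated_increments_continuous trajectory_dominated_increments s z)
  then obtain x where x: "x \<in> {s..t}" "\<And>r. r \<in> {s..t} \<Longrightarrow> norm (\<phi> s r z) \<le> norm (\<phi> s x z)"
    using continuous_attains_sup[of "{s..t}" "\<lambda>r. norm (\<phi> s r z)"] s by auto
  show ?thesis
    by (rule that[of "norm (\<phi> s x z)"]) (use x trajectory_in_disc[of s x z] s z in auto)
qed

lemma trajectory_derivative:
  assumes s: "0 \<le> s" and z: "z \<in> unit_disc"
  obtains N where "negligible N"
    "\<And>r. \<lbrakk>r \<in> {s..t}; r \<notin> N\<rbrakk> \<Longrightarrow> ((\<lambda>r. \<phi> s r z) has_vector_derivative
       (\<phi> s r z - \<sigma>) * (cnj \<sigma> * \<phi> s r z - 1) * p (\<phi> s r z) r) (at r within {s..t})"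
proof -
  obtain N where "negligible N" and N: "{r. \<not> (s \<le> r \<longrightarrow> ((\<lambda>r. \<phi> s r z) has_vector_derivative
       (\<phi> s r z - \<sigma>) * (cnj \<sigma> * \<phi> s r z - 1) * p (\<phi> s r z) r) (at r within {s..}))} \<subseteq> N"
    using ode[OF z s] unfolding eventually_ae_filter_negligible by blast
  show ?thesis
  proof (rule that[OF \<open>negligible N\<close>])
    fix r assume r: "r \<in> {s..t}" "r \<notin> N"
    then have "((\<lambda>r. \<phi> s r z) has_vector_derivative
       (\<phi> s r z - \<sigma>) * (cnj \<sigma> * \<phi> s r z - 1) * p (\<phi> s r z) r) (at r within {s..})"
      using N by auto
    then show "((\<lambda>r. \<phi> s r z) has_vector_derivative
       (\<phi> s r z - \<sigma>) * (cnj \<sigma> * \<phi> s r z - 1) * p (\<phi> s r z) r) (at r within {s..t})"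
      by (rule has_vector_derivative_within_subset) auto
  qed
qed

lemma herglotz_L_on:
  assumes "z \<in> unit_disc" "0 < T"
  shows "L_on d {0..T} (p z)"
  using herglotz assms unfolding herglotz_function_def L_loc_def by blast

lemma herglotz_holomorphic:
  assumes "0 \<le> t"
  shows "(\<lambda>z. p z t) holomorphic_on unit_disc"
  using herglotz assms unfolding herglotz_function_def by blast

lemma herglotz_Re_nonneg:
  assumes "0 \<le> t" "z \<in> unit_disc"
  shows "0 \<le> Re (p z t)"
  using herglotz assms unfolding herglotz_function_def by blast

lemma herglotz_absolutely_integrable:
  assumes z: "z \<in> unit_disc" and s: "0 \<le> s"
  shows "p z absolutely_integrable_on {s..t}"
proof -
  have "p z absolutely_integrable_on {0..\<bar>t\<bar> + 1}"
    by (rule L_on_imp_absolutely_integrable[OF herglotz_L_on[OF z] d_ge_1]) auto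
  then show ?thesis by (rule absolutely_integrable_on_subinterval) (use s in auto)
qed

lemma herglotz_trajectory_measurable:
  assumes s: "0 \<le> s" "s \<le> t" and z: "z \<in> unit_disc"
  shows "set_borel_measurable lebesgue {s..t} (\<lambda>r. p (\<phi> s r z) r)"
proof (rule set_borel_measurable_caratheodory[where U = unit_disc and p = p and w = "\<lambda>r. \<phi> s r z"])
  show "set_borel_measurable lebesgue {s..t} (p w)" if "w \<in> unit_disc" for w
    using herglotz_absolutely_integrable[OF that s(1), of t]
    unfolding set_borel_measurable_def set_integrable_def by (rule borel_measurable_integrable)
  show "continuous_on unit_disc (\<lambda>w. p w r)" if "r \<in> {s..t}" for r
    using herglotz_holomorphic[of r] that s holomorphic_on_imp_continuous_on by auto
  show "continuous_on {s..t} (\<lambda>r. \<phi> s r z)"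
    by (intro dominated_increments_continuous trajectory_dominated_increments s z)
  show "(\<lambda>r. \<phi> s r z) ` {s..t} \<subseteq> unit_disc"
    using trajectory_in_disc s z by auto
qed

lemma herglotz_trajectory_absolutely_integrable:
  assumes s: "0 \<le> s" "s \<le> t" and z: "z \<in> unit_disc"
  shows "(\<lambda>r. p (\<phi> s r z) r) absolutely_integrable_on {s..t}"
proof -
  obtain \<rho> where \<rho>: "\<rho> < 1" "\<And>r. r \<in> {s..t} \<Longrightarrow> norm (\<phi> s r z) \<le> \<rho>"
    using trajectory_norm_le[OF assms] by blast
  have "(\<lambda>r. of_real (1 + 4 / (1 - \<rho>\<^sup>2)) * p 0 r) absolutely_integrable_on {s..t}"
    by (intro set_integrable_mult_right herglotz_absolutely_integrable s) auto
  then show ?thesis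
  proof (rule set_integrable_bound[OF _ herglotz_trajectory_measurable[OF assms]])
    show "AE r in lebesgue. r \<in> {s..t} \<longrightarrow>
      norm (p (\<phi> s r z) r) \<le> norm (of_real (1 + 4 / (1 - \<rho>\<^sup>2)) * p 0 r)"
    proof (intro AE_I2 impI)
      fix r assume r: "r \<in> {s..t}"
      have "norm (p (\<phi> s r z) r) \<le> (1 + 4 / (1 - \<rho>\<^sup>2)) * norm (p 0 r)"
        by (rule norm_le_of_Re_nonneg_cball[OF herglotz_holomorphic herglotz_Re_nonneg \<rho>(2)[OF r] \<rho>(1)])
           (use r s in auto)
      also have "\<dots> \<le> \<bar>1 + 4 / (1 - \<rho>\<^sup>2)\<bar> * norm (p 0 r)" by (intro mult_right_mono) auto
      finally show "norm (p (\<phi> s r z) r) \<le> norm (of_real (1 + 4 / (1 - \<rho>\<^sup>2)) * p 0 r)"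
        unfolding norm_mult norm_of_real .
    qed
  qed
qed

text \<open>
  Every requirement on a spectral function except the multiplier identity holds for the
  primitive of any locally \<open>L\<^sup>d\<close> function with nonnegative real part.
\<close>
lemma spectral_function_integral:
  assumes g: "L_loc d g" and Re_g: "\<And>t. 0 \<le> t \<Longrightarrow> 0 \<le> Re (g t)"
    and deriv: "\<And>s t. \<lbrakk>0 \<le> s; s \<le> t\<rbrakk> \<Longrightarrow>
       has_derivative_at_fixed_point (\<phi> s t) (exp (- integral {s..t} g)) \<sigma>"
  shows "spectral_function d \<phi> \<sigma> (\<lambda>t. integral {0..t} g)"
proof -
  have ai: "g absolutely_integrable_on {s..t}" if "0 \<le> s" for s t
  proof -
    have "g absolutely_integrable_on {0..\<bar>t\<bar> + 1}"
      using g unfolding L_loc_def by (intro L_on_imp_absolutely_integrable[OF _ d_ge_1]) auto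
    then show ?thesis by (rule absolutely_integrable_on_subinterval) (use that in auto)
  qed
  have int: "g integrable_on {s..t}" if "0 \<le> s" for s t
    using set_lebesgue_integral_eq_integral(1)[OF ai[OF that]] .
  have diff: "integral {0..s} g - integral {0..t} g = - integral {s..t} g" if "0 \<le> s" "s \<le> t" for s t
    using Henstock_Kurzweil_Integration.integral_combine[OF that int] by (simp add: algebra_simps)
  have Re_nonneg: "0 \<le> Re (integral {s..t} g)" if "0 \<le> s" for s t
    using has_integral_linear[OF integrable_integral[OF int[OF that]] bounded_linear_Re]
    by (rule has_integral_nonneg) (use Re_g that in auto)
  show ?thesis
    unfolding spectral_function_def
  proof (intro conjI allI impI)
    show "locally_absolutely_continuous (\<lambda>t. integral {0..t} g)"
      unfolding locally_absolutely_continuous_def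
      by (intro allI impI absolutely_continuous_on_integral ai) simp
    obtain N where "negligible N" "\<And>t. \<lbrakk>0 \<le> t; t \<notin> N\<rbrakk> \<Longrightarrow>
        ((\<lambda>x. integral {0..x} g) has_vector_derivative g t) (at t within {0..})"
      using indefinite_integral_has_vector_derivative_ae[OF int[of 0]] by auto
    then show "derivative_L_loc d (\<lambda>t. integral {0..t} g)"
      unfolding derivative_L_loc_def eventually_ae_filter_negligible using g by blast
    fix s t :: real assume st: "0 \<le> s" "s \<le> t"
    show "0 \<le> Re (integral {0..s} g)" by (rule Re_nonneg) simp
    have "integral {0..t} g = integral {0..s} g + integral {s..t} g" using diff[OF st] by (simp add: algebra_simps)
    then show "Re (integral {0..s} g) \<le> Re (integral {0..t} g)" using Re_nonneg[OF st(1), of t] by simp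
    show "has_derivative_at_fixed_point (\<phi> s t) (exp (integral {0..s} g - integral {0..t} g)) \<sigma>"
      unfolding diff[OF st] by (rule deriv[OF st])
  qed simp
qed

end

section \<open>Interior fixed point\<close>

context evolution_with_constant_tau
begin

text \<open>
  Trajectories do not move away from \<open>\<sigma>\<close> in the pseudo-hyperbolic distance, because the
  coefficient of the linear equation for the Moebius coordinate has nonpositive real part. In
  Euclidean terms this gives a bound that is uniform in time; in particular \<open>\<sigma>\<close> is a common
  fixed point.
\<close>
lemma trajectory_attracted:
  assumes in_disc: "\<sigma> \<in> unit_disc" and s: "0 \<le> s" "s \<le> t" and z: "z \<in> unit_disc"
  shows "norm (\<phi> s t z - \<sigma>) \<le> 2 * norm (z - \<sigma>) / (1 - norm \<sigma>)"
proof -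
  \<comment> \<open>\<open>m\<close> is the disc automorphism that sends \<open>\<sigma>\<close> to \<open>0\<close>, and \<open>X\<close> solves
    \<open>X' = - \<kappa> p X\<close> along the trajectory.\<close>
  define m where "m = (\<lambda>w. (w - \<sigma>) / (1 - cnj \<sigma> * w))"
  define X where "X = (\<lambda>r. m (\<phi> s r z))"
  define \<kappa> where "\<kappa> = 1 - (norm \<sigma>)\<^sup>2"
  have \<kappa>: "complex_of_real \<kappa> = 1 - \<sigma> * cnj \<sigma>" by (simp add: \<kappa>_def complex_norm_square[symmetric] flip: of_real_power)
  have \<kappa>0: "0 \<le> \<kappa>" using in_disc by (simp add: \<kappa>_def abs_square_le_1)
  have \<sigma>1: "norm \<sigma> < 1" using in_disc by simp
  have lower: "1 - norm \<sigma> \<le> norm (1 - cnj \<sigma> * w)" if "w \<in> unit_disc" for w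
  proof -
    have "norm (cnj \<sigma> * w) \<le> norm \<sigma> * 1" unfolding norm_mult complex_mod_cnj
      by (rule mult_left_mono) (use that in auto)
    then show ?thesis using norm_triangle_ineq2[of 1 "cnj \<sigma> * w"] by simp
  qed
  have upper: "norm (1 - cnj \<sigma> * w) \<le> 2" if "w \<in> unit_disc" for w
    using norm_triangle_ineq4[of 1 "cnj \<sigma> * w"] mult_mono[of "norm \<sigma>" 1 "norm w" 1] \<sigma>1 that
    by (simp add: norm_mult)
  have nz: "1 - cnj \<sigma> * w \<noteq> 0" if "w \<in> unit_disc" for w using lower[OF that] \<sigma>1 by auto
  have disc: "\<phi> s r z \<in> unit_disc" if "r \<in> {s..t}" for r using trajectory_in_disc that s z by auto
  have X: "dominated_increments s t X"
  proof (rule dominated_increments_lipschitz[OF trajectory_dominated_increments[OF s z]])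
    show "0 \<le> \<kappa> / (1 - norm \<sigma>)\<^sup>2" using \<kappa>0 by simp
    fix u v assume "u \<in> {s..t}" "v \<in> {s..t}"
    define a b where "a = \<phi> s u z" and "b = \<phi> s v z"
    have ab: "a \<in> unit_disc" "b \<in> unit_disc" using disc \<open>u \<in> _\<close> \<open>v \<in> _\<close> by (auto simp: a_def b_def)
    have "m b - m a = \<kappa> * (b - a) / ((1 - cnj \<sigma> * a) * (1 - cnj \<sigma> * b))"
      using nz ab unfolding m_def \<kappa> by (simp add: divide_simps) (simp add: algebra_simps)
    then have "norm (m b - m a) = \<kappa> * norm (b - a) / (norm (1 - cnj \<sigma> * a) * norm (1 - cnj \<sigma> * b))"
      using \<kappa>0 by (simp add: norm_mult norm_divide)
    also have "\<dots> \<le> \<kappa> * norm (b - a) / (1 - norm \<sigma>)\<^sup>2"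
      unfolding power2_eq_square using \<kappa>0 \<sigma>1 lower ab nz
      by (intro divide_left_mono mult_mono mult_pos_pos) auto
    finally show "norm (X v - X u) \<le> \<kappa> / (1 - norm \<sigma>)\<^sup>2 * norm (\<phi> s v z - \<phi> s u z)"
      by (simp add: X_def a_def b_def)
  qed
  obtain N where N: "negligible N"
    and der: "\<And>r. \<lbrakk>r \<in> {s..t}; r \<notin> N\<rbrakk> \<Longrightarrow> ((\<lambda>r. \<phi> s r z) has_vector_derivative
       (\<phi> s r z - \<sigma>) * (cnj \<sigma> * \<phi> s r z - 1) * p (\<phi> s r z) r) (at r within {s..t})"
    using trajectory_derivative[OF s(1) z] by blast
  have ai: "(\<lambda>r. - of_real \<kappa> * p (\<phi> s r z) r) absolutely_integrable_on {s..t}"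
    by (intro set_integrable_mult_right herglotz_trajectory_absolutely_integrable s z)
  have "X t = X s * exp (integral {s..t} (\<lambda>r. - of_real \<kappa> * p (\<phi> s r z) r))"
  proof (rule linear_ode_solution[OF s(2) X ai N])
    fix r assume r: "r \<in> {s..t}" "r \<notin> N"
    define w where "w = \<phi> s r z"
    have w: "1 - cnj \<sigma> * w \<noteq> 0" using nz disc r by (simp add: w_def)
    have "(m has_field_derivative \<kappa> / (1 - cnj \<sigma> * w)\<^sup>2) (at w within (\<lambda>r. \<phi> s r z) ` {s..t})"
      unfolding m_def using w
      by (auto intro!: derivative_eq_intros simp: \<kappa> power2_eq_square divide_simps) (simp add: algebra_simps)
    from field_vector_diff_chain_within[OF der[OF r], of m, folded w_def, OF this]
    have "(X has_vector_derivative (w - \<sigma>) * (cnj \<sigma> * w - 1) * p w r * (\<kappa> / (1 - cnj \<sigma> * w)\<^sup>2))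
        (at r within {s..t})"
      by (simp add: X_def o_def)
    moreover have "(w - \<sigma>) * (cnj \<sigma> * w - 1) * p w r * (\<kappa> / (1 - cnj \<sigma> * w)\<^sup>2) = - of_real \<kappa> * p w r * X r"
      using w unfolding X_def m_def w_def[symmetric]
      by (simp add: power2_eq_square divide_simps) (simp add: algebra_simps)
    ultimately show "(X has_vector_derivative - of_real \<kappa> * p (\<phi> s r z) r * X r) (at r within {s..t})"
      by (simp add: w_def)
  qed
  then have Xt: "norm (X t) = norm (X s) * exp (Re (integral {s..t} (\<lambda>r. - of_real \<kappa> * p (\<phi> s r z) r)))"
    by (simp add: norm_mult)
  have "Re (integral {s..t} (\<lambda>r. - of_real \<kappa> * p (\<phi> s r z) r)) \<le> 0"
  proof -
    have "((\<lambda>r. Re (- of_real \<kappa> * p (\<phi> s r z) r)) has_integral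
        Re (integral {s..t} (\<lambda>r. - of_real \<kappa> * p (\<phi> s r z) r))) {s..t}"
      using has_integral_linear[OF integrable_integral[OF set_lebesgue_integral_eq_integral(1)[OF ai]] bounded_linear_Re]
      by (simp add: o_def)
    then show ?thesis
      by (rule has_integral_le[OF _ has_integral_0]) (use \<kappa>0 herglotz_Re_nonneg disc s in auto)
  qed
  then have "norm (X t) \<le> norm (X s)" unfolding Xt by (simp add: mult_left_le)
  also have "X s = (z - \<sigma>) / (1 - cnj \<sigma> * z)" by (simp add: X_def m_def trajectory_initial[OF s(1) z])
  also have "norm \<dots> \<le> norm (z - \<sigma>) / (1 - norm \<sigma>)"
    unfolding norm_divide using lower[OF z] nz[OF z] \<sigma>1 by (intro divide_left_mono mult_pos_pos) auto
  finally have "norm (X t) \<le> norm (z - \<sigma>) / (1 - norm \<sigma>)" .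
  moreover have "\<phi> s t z - \<sigma> = X t * (1 - cnj \<sigma> * \<phi> s t z)"
    using nz disc s by (simp add: X_def m_def)
  then have "norm (\<phi> s t z - \<sigma>) \<le> norm (X t) * 2"
    using upper disc[of t] s by (simp add: norm_mult mult_left_mono)
  ultimately show ?thesis by simp
qed

lemma interior_fixed_point:
  assumes "\<sigma> \<in> unit_disc" "0 \<le> s" "s \<le> t"
  shows "\<phi> s t \<sigma> = \<sigma>"
  using trajectory_attracted[OF assms assms(1)] by simp

text \<open>
  The difference \<open>w - \<sigma>\<close> along a trajectory \<open>w\<close> solves a linear equation with coefficient
  \<open>(cnj \<sigma> * w - 1) * p w\<close>. As the starting point tends to \<open>\<sigma>\<close>, the coefficient tends to
  \<open>((norm \<sigma>)\<^sup>2 - 1) * p \<sigma>\<close> and is dominated by a multiple of \<open>norm (p 0)\<close>.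
\<close>
lemma interior_derivative:
  assumes in_disc: "\<sigma> \<in> unit_disc" and s: "0 \<le> s" "s \<le> t"
  shows "(\<phi> s t has_field_derivative
           exp (- integral {s..t} (\<lambda>r. of_real (1 - (norm \<sigma>)\<^sup>2) * p \<sigma> r))) (at \<sigma>)"
proof -
  let ?D = "exp (- integral {s..t} (\<lambda>r. of_real (1 - (norm \<sigma>)\<^sup>2) * p \<sigma> r))"
  define \<delta> where "\<delta> = 1 - norm \<sigma>"
  have \<delta>: "\<delta> > 0" "norm \<sigma> = 1 - \<delta>" using in_disc by (auto simp: \<delta>_def)
  \<comment> \<open>Starting points within \<open>\<delta>\<^sup>2 / 4\<close> of \<open>\<sigma>\<close> have trajectories within \<open>\<delta> / 2\<close> of \<open>\<sigma>\<close>,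
    hence inside the disc of radius \<open>\<rho>\<close>.\<close>
  define \<rho> where "\<rho> = 1 - \<delta> / 2"
  have \<rho>: "\<rho> < 1" using \<delta> by (simp add: \<rho>_def)
  have limit: "(\<lambda>n. (\<phi> s t (Z n) - \<sigma>) / (Z n - \<sigma>)) \<longlonglongrightarrow> ?D"
    if Z: "Z \<longlonglongrightarrow> \<sigma>" "\<And>n. Z n \<in> unit_disc" "\<And>n. Z n \<noteq> \<sigma>" "\<And>n. norm (Z n - \<sigma>) \<le> \<delta>\<^sup>2 / 4" for Z
  proof -
    define w where "w = (\<lambda>n r. \<phi> s r (Z n))"
    define X where "X = (\<lambda>n r. w n r - \<sigma>)"
    define \<alpha> where "\<alpha> = (\<lambda>n r. (cnj \<sigma> * w n r - 1) * p (w n r) r)"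
    have disc: "w n r \<in> unit_disc" if "r \<in> {s..t}" for n r using trajectory_in_disc that s Z by (auto simp: w_def)
    have near: "norm (w n r - \<sigma>) \<le> 2 * norm (Z n - \<sigma>) / \<delta>" if "r \<in> {s..t}" for n r
      using trajectory_attracted[OF in_disc s(1) _ Z(2)] that by (auto simp: w_def \<delta>_def)
    have w\<rho>: "norm (w n r) \<le> \<rho>" if "r \<in> {s..t}" for n r
    proof -
      have "norm (w n r - \<sigma>) \<le> 2 * (\<delta>\<^sup>2 / 4) / \<delta>"
        by (rule order_trans[OF near[OF that]], intro divide_right_mono mult_left_mono Z) (use \<delta> in auto)
      then show ?thesis using norm_triangle_ineq[of "w n r - \<sigma>" \<sigma>] \<delta> by (simp add: \<rho>_def power2_eq_square)
    qed
    have wlim: "(\<lambda>n. w n r) \<longlonglongrightarrow> \<sigma>" if "r \<in> {s..t}" for r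
    proof -
      have "(\<lambda>n. 2 * norm (Z n - \<sigma>) / \<delta>) \<longlonglongrightarrow> 2 * norm (\<sigma> - \<sigma>) / \<delta>"
        by (intro tendsto_intros Z) (use \<delta> in auto)
      then have "(\<lambda>n. 2 * norm (Z n - \<sigma>) / \<delta>) \<longlonglongrightarrow> 0" by simp
      moreover have "\<forall>\<^sub>F n in sequentially. norm (w n r - \<sigma>) \<le> 2 * norm (Z n - \<sigma>) / \<delta>"
        by (intro always_eventually allI near[OF that])
      ultimately have "(\<lambda>n. w n r - \<sigma>) \<longlonglongrightarrow> 0" by (rule Lim_null_comparison[rotated])
      then show ?thesis by (simp add: LIM_zero_iff)
    qed
    have "\<forall>n. \<exists>N. negligible N \<and> (\<forall>r. r \<in> {s..t} \<longrightarrow> r \<notin> N \<longrightarrow> (w n has_vector_derivative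
       (w n r - \<sigma>) * (cnj \<sigma> * w n r - 1) * p (w n r) r) (at r within {s..t}))"
      using trajectory_derivative[OF s(1) Z(2)] unfolding w_def by metis
    then obtain N where N: "\<And>n. negligible (N n)" and
      der: "\<And>n r. \<lbrakk>r \<in> {s..t}; r \<notin> N n\<rbrakk> \<Longrightarrow> (w n has_vector_derivative
       (w n r - \<sigma>) * (cnj \<sigma> * w n r - 1) * p (w n r) r) (at r within {s..t})"
      by metis
    define h where "h = (\<lambda>r. 2 * (1 + 4 / (1 - \<rho>\<^sup>2)) * norm (p 0 r))"
    have "(\<lambda>n. X n t / X n s) \<longlonglongrightarrow> exp (integral {s..t} (\<lambda>r. (cnj \<sigma> * \<sigma> - 1) * p \<sigma> r))"
    proof (rule linear_ode_limit[OF s(2) _ N, where \<alpha> = \<alpha> and h = h])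
      show "dominated_increments s t (X n)" for n
        by (rule dominated_increments_lipschitz[OF trajectory_dominated_increments[OF s Z(2)], where L = 1])
           (auto simp: X_def w_def)
      show "(X n has_vector_derivative \<alpha> n r * X n r) (at r within {s..t})"
        if "r \<in> {s..t}" "r \<notin> N n" for n r
        using has_vector_derivative_diff[OF der[OF that] has_vector_derivative_const[of \<sigma>]]
        by (simp add: X_def \<alpha>_def mult_ac)
      show "set_borel_measurable lebesgue {s..t} (\<alpha> n)" for n
        unfolding \<alpha>_def w_def
        by (intro set_borel_measurable_continuous_mult herglotz_trajectory_measurable s Z(2)
              continuous_intros dominated_increments_continuous trajectory_dominated_increments)
      show "h integrable_on {s..t}"
        unfolding h_def using herglotz_absolutely_integrable[of 0 s t] s
        by (intro integrable_on_mult_right) (simp add: absolutely_integrable_on_def)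
      show "norm (\<alpha> n r) \<le> h r" if "r \<in> {s..t}" for n r
      proof -
        have "norm (cnj \<sigma> * w n r - 1) \<le> norm (cnj \<sigma> * w n r) + norm (1::complex)" by (rule norm_triangle_ineq4)
        also have "norm (cnj \<sigma> * w n r) \<le> 1 * 1" unfolding norm_mult
          using in_disc disc[OF that, of n] by (intro mult_mono) auto
        finally have "norm (cnj \<sigma> * w n r - 1) \<le> 2" by simp
        moreover have "norm (p (w n r) r) \<le> (1 + 4 / (1 - \<rho>\<^sup>2)) * norm (p 0 r)"
          by (rule norm_le_of_Re_nonneg_cball[OF herglotz_holomorphic herglotz_Re_nonneg w\<rho>[OF that] \<rho>])
             (use that s in auto)
        ultimately have "norm (cnj \<sigma> * w n r - 1) * norm (p (w n r) r) \<le> 2 * ((1 + 4 / (1 - \<rho>\<^sup>2)) * norm (p 0 r))"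
          by (rule mult_mono) auto
        then show ?thesis unfolding \<alpha>_def h_def norm_mult mult.assoc .
      qed
      show "(\<lambda>n. \<alpha> n r) \<longlonglongrightarrow> (cnj \<sigma> * \<sigma> - 1) * p \<sigma> r" if "r \<in> {s..t}" for r
      proof -
        have "continuous_on unit_disc (\<lambda>z. p z r)"
          using herglotz_holomorphic[of r] that s holomorphic_on_imp_continuous_on by auto
        then have "(\<lambda>n. p (w n r) r) \<longlonglongrightarrow> p \<sigma> r"
          by (rule continuous_on_tendsto_compose[OF _ wlim[OF that] in_disc])
             (use disc[OF that] in \<open>auto intro: always_eventually\<close>)
        then show ?thesis unfolding \<alpha>_def by (intro tendsto_intros wlim that)
      qed
      show "X n s \<noteq> 0" for n using Z(2,3)[of n] by (simp add: X_def w_def trajectory_initial[OF s(1) Z(2)])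
    qed
    moreover have "cnj \<sigma> * \<sigma> = of_real ((norm \<sigma>)\<^sup>2)" by (simp add: complex_norm_square mult.commute del: of_real_power)
    then have "(\<lambda>r. (cnj \<sigma> * \<sigma> - 1) * p \<sigma> r) = (\<lambda>r. - (of_real (1 - (norm \<sigma>)\<^sup>2) * p \<sigma> r))"
      by (simp only:) (simp add: algebra_simps)
    moreover have "X n t / X n s = (\<phi> s t (Z n) - \<sigma>) / (Z n - \<sigma>)" for n
      using Z(2) by (simp add: X_def w_def trajectory_initial[OF s(1) Z(2)])
    ultimately show ?thesis by simp
  qed
  show ?thesis
    unfolding has_field_derivative_iff
  proof (subst tendsto_at_iff_sequentially, intro allI impI)
    fix Y assume Y: "\<forall>i. Y i \<in> UNIV - {\<sigma>}" and lim: "Y \<longlonglongrightarrow> \<sigma>"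
    have "\<forall>\<^sub>F n in sequentially. Y n \<in> unit_disc"
      using topological_tendstoD[OF lim _ in_disc] by simp
    moreover have "\<forall>\<^sub>F n in sequentially. norm (Y n - \<sigma>) < \<delta>\<^sup>2 / 4"
      using tendstoD[OF lim, of "\<delta>\<^sup>2 / 4"] \<delta> by (simp add: dist_norm)
    ultimately obtain n0 where n0: "\<And>n. n \<ge> n0 \<Longrightarrow> Y n \<in> unit_disc \<and> norm (Y n - \<sigma>) < \<delta>\<^sup>2 / 4"
      unfolding eventually_sequentially by (metis linorder_le_cases order_trans)
    have "(\<lambda>n. (\<phi> s t (Y (n + n0)) - \<sigma>) / (Y (n + n0) - \<sigma>)) \<longlonglongrightarrow> ?D"
      by (rule limit) (use Y n0 LIMSEQ_ignore_initial_segment[OF lim] in \<open>auto intro: less_imp_le\<close>)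
    then have "(\<lambda>n. (\<phi> s t (Y n) - \<sigma>) / (Y n - \<sigma>)) \<longlonglongrightarrow> ?D"
      by (rule LIMSEQ_offset)
    then show "((\<lambda>y. (\<phi> s t y - \<phi> s t \<sigma>) / (y - \<sigma>)) \<circ> Y) \<longlonglongrightarrow> ?D"
      by (simp add: o_def interior_fixed_point[OF in_disc s])
  qed
qed

lemma interior_spectral_function:
  assumes in_disc: "\<sigma> \<in> unit_disc"
  shows "spectral_function d \<phi> \<sigma> (\<lambda>t. integral {0..t} (\<lambda>r. of_real (1 - (norm \<sigma>)\<^sup>2) * p \<sigma> r))"
proof (rule spectral_function_integral)
  show "L_loc d (\<lambda>r. of_real (1 - (norm \<sigma>)\<^sup>2) * p \<sigma> r)"
    unfolding L_loc_def
  proof (intro allI impI)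
    fix T :: real assume "0 < T"
    have L: "L_on d {0..T} (p \<sigma>)" by (rule herglotz_L_on[OF in_disc \<open>0 < T\<close>])
    show "L_on d {0..T} (\<lambda>r. of_real (1 - (norm \<sigma>)\<^sup>2) * p \<sigma> r)"
    proof (rule L_on_dominated[OF L])
      show "set_borel_measurable lebesgue {0..T} (\<lambda>r. of_real (1 - (norm \<sigma>)\<^sup>2) * p \<sigma> r)"
        using L unfolding L_on_def by (intro set_borel_measurable_continuous_mult) (auto intro: continuous_intros)
      show "norm (of_real (1 - (norm \<sigma>)\<^sup>2) * p \<sigma> t) \<le> \<bar>1 - (norm \<sigma>)\<^sup>2\<bar> * norm (p \<sigma> t)" for t
        unfolding norm_mult norm_of_real ..
    qed auto
  qed
  show "0 \<le> Re (of_real (1 - (norm \<sigma>)\<^sup>2) * p \<sigma> t)" if "0 \<le> t" for t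
  proof -
    have "Re (of_real k * w) = k * Re w" for k w by simp
    then show ?thesis using herglotz_Re_nonneg[OF that in_disc] in_disc by (simp only:) (simp add: abs_square_le_1)
  qed
  show "has_derivative_at_fixed_point (\<phi> s t) (exp (- integral {s..t} (\<lambda>r. of_real (1 - (norm \<sigma>)\<^sup>2) * p \<sigma> r))) \<sigma>"
    if "0 \<le> s" "s \<le> t" for s t
    using interior_derivative[OF in_disc that] in_disc unfolding has_derivative_at_fixed_point_def by auto
qed

end

section \<open>Boundary fixed point\<close>

context evolution_with_constant_tau
begin

lemma half_plane_trajectory_dominated_increments:
  assumes bd: "norm \<sigma> = 1" and s: "0 \<le> s" "s \<le> t" and z: "z \<in> unit_disc"
  shows "dominated_increments s t (\<lambda>r. half_plane_map \<sigma> (\<phi> s r z))"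
proof -
  obtain \<rho> where \<rho>: "\<rho> < 1" "\<And>r. r \<in> {s..t} \<Longrightarrow> norm (\<phi> s r z) \<le> \<rho>"
    using trajectory_norm_le[OF s z] by blast
  show ?thesis
  proof (rule dominated_increments_lipschitz[OF trajectory_dominated_increments[OF s z]])
    show "0 \<le> 2 / (1 - \<rho>)\<^sup>2" by simp
    fix u v assume "u \<in> {s..t}" "v \<in> {s..t}"
    define a b where "a = \<phi> s u z" and "b = \<phi> s v z"
    have ab: "norm a \<le> \<rho>" "norm b \<le> \<rho>" using \<rho> \<open>u \<in> _\<close> \<open>v \<in> _\<close> by (auto simp: a_def b_def)
    have lower: "1 - \<rho> \<le> norm (\<sigma> - a)" "1 - \<rho> \<le> norm (\<sigma> - b)"
      using norm_triangle_ineq2[of \<sigma> a] norm_triangle_ineq2[of \<sigma> b] ab bd by auto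
    then have ne: "\<sigma> \<noteq> a" "\<sigma> \<noteq> b" using \<rho>(1) by auto
    have "half_plane_map \<sigma> b - half_plane_map \<sigma> a = 2 * \<sigma> * (b - a) / ((\<sigma> - a) * (\<sigma> - b))"
      using ne unfolding half_plane_map_def by (simp add: divide_simps) (simp add: algebra_simps)
    then have "norm (half_plane_map \<sigma> b - half_plane_map \<sigma> a) = 2 * norm (b - a) / (norm (\<sigma> - a) * norm (\<sigma> - b))"
      using bd by (simp add: norm_mult norm_divide)
    also have "\<dots> \<le> 2 * norm (b - a) / (1 - \<rho>)\<^sup>2"
      unfolding power2_eq_square using lower ne \<rho>(1)
      by (intro divide_left_mono mult_mono mult_pos_pos) auto
    finally show "norm (half_plane_map \<sigma> (\<phi> s v z) - half_plane_map \<sigma> (\<phi> s u z))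
        \<le> 2 / (1 - \<rho>)\<^sup>2 * norm (\<phi> s v z - \<phi> s u z)"
      by (simp add: a_def b_def)
  qed
qed

text \<open>
  The derivative of the half-plane coordinate has a double pole at \<open>\<sigma>\<close> that cancels the double
  zero of the vector field there, so that the equation becomes \<open>W' = 2 * p\<close>.
\<close>
lemma half_plane_trajectory_derivative:
  assumes bd: "norm \<sigma> = 1" and s: "0 \<le> s" and z: "z \<in> unit_disc"
  obtains N where "negligible N"
    "\<And>r. \<lbrakk>r \<in> {s..t}; r \<notin> N\<rbrakk> \<Longrightarrow> ((\<lambda>r. half_plane_map \<sigma> (\<phi> s r z)) has_vector_derivative
       2 * p (\<phi> s r z) r) (at r within {s..t})"
proof -
  obtain N where N: "negligible N"
    and der: "\<And>r. \<lbrakk>r \<in> {s..t}; r \<notin> N\<rbrakk> \<Longrightarrow> ((\<lambda>r. \<phi> s r z) has_vector_derivative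
       (\<phi> s r z - \<sigma>) * (cnj \<sigma> * \<phi> s r z - 1) * p (\<phi> s r z) r) (at r within {s..t})"
    using trajectory_derivative[OF s(1) z] by blast
  show ?thesis
  proof (rule that[OF N])
    fix r assume r: "r \<in> {s..t}" "r \<notin> N"
    define w where "w = \<phi> s r z"
    have "w \<in> unit_disc" using trajectory_in_disc[of s r z] s z r by (simp add: w_def)
    then have ne: "\<sigma> \<noteq> w" using bd by auto
    have "(half_plane_map \<sigma> has_field_derivative 2 * \<sigma> / (\<sigma> - w)\<^sup>2) (at w within (\<lambda>r. \<phi> s r z) ` {s..t})"
      unfolding half_plane_map_def using ne
      by (auto intro!: derivative_eq_intros simp: power2_eq_square divide_simps)
    from field_vector_diff_chain_within[OF der[OF r], of "half_plane_map \<sigma>", folded w_def, OF this]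
    have "((\<lambda>r. half_plane_map \<sigma> (\<phi> s r z)) has_vector_derivative
        (w - \<sigma>) * (cnj \<sigma> * w - 1) * p w r * (2 * \<sigma> / (\<sigma> - w)\<^sup>2)) (at r within {s..t})"
      by (simp add: o_def)
    moreover have "(w - \<sigma>) * (cnj \<sigma> * w - 1) * p w r * (2 * \<sigma> / (\<sigma> - w)\<^sup>2) = 2 * p w r"
    proof -
      \<comment> \<open>On the unit circle the two factors of the field combine into a square.\<close>
      have "\<sigma> * cnj \<sigma> = 1" using bd by (simp add: complex_norm_square[symmetric])
      then have eq: "(cnj \<sigma> * w - 1) * \<sigma> = w - \<sigma>" by (simp add: algebra_simps)
      have "(w - \<sigma>) * (cnj \<sigma> * w - 1) * p w r * (2 * \<sigma> / (\<sigma> - w)\<^sup>2)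
          = 2 * p w r * ((w - \<sigma>) * ((cnj \<sigma> * w - 1) * \<sigma>)) / (\<sigma> - w)\<^sup>2"
        by (simp add: mult_ac)
      also have "\<dots> = 2 * p w r * ((w - \<sigma>) * (w - \<sigma>)) / (\<sigma> - w)\<^sup>2" unfolding eq ..
      also have "(w - \<sigma>) * (w - \<sigma>) = (\<sigma> - w)\<^sup>2" by (simp add: power2_eq_square algebra_simps)
      finally show ?thesis using ne by simp
    qed
    ultimately show "((\<lambda>r. half_plane_map \<sigma> (\<phi> s r z)) has_vector_derivative
       2 * p (\<phi> s r z) r) (at r within {s..t})" by (simp add: w_def)
  qed
qed

lemma half_plane_trajectory_Re_mono:
  assumes bd: "norm \<sigma> = 1" and s: "0 \<le> s" "s \<le> t" and z: "z \<in> unit_disc"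
  shows "Re (half_plane_map \<sigma> z) \<le> Re (half_plane_map \<sigma> (\<phi> s t z))"
proof -
  obtain N where N: "negligible N"
    and der: "\<And>r. \<lbrakk>r \<in> {s..t}; r \<notin> N\<rbrakk> \<Longrightarrow> ((\<lambda>r. half_plane_map \<sigma> (\<phi> s r z)) has_vector_derivative
       2 * p (\<phi> s r z) r) (at r within {s..t})"
    using half_plane_trajectory_derivative[OF bd s(1) z] by blast
  have "((\<lambda>r. 2 * p (\<phi> s r z) r) has_integral
      (half_plane_map \<sigma> (\<phi> s t z) - half_plane_map \<sigma> (\<phi> s s z))) {s..t}"
    by (rule dominated_increments_has_integral[OF s(2) half_plane_trajectory_dominated_increments[OF bd s z] N der])
  from has_integral_linear[OF this bounded_linear_Re]
  have "((\<lambda>r. Re (2 * p (\<phi> s r z) r)) has_integral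
      Re (half_plane_map \<sigma> (\<phi> s t z) - half_plane_map \<sigma> z)) {s..t}"
    by (simp add: o_def trajectory_initial[OF s(1) z])
  then have "0 \<le> Re (half_plane_map \<sigma> (\<phi> s t z) - half_plane_map \<sigma> z)"
    by (rule has_integral_nonneg) (use herglotz_Re_nonneg trajectory_in_disc[OF s(1) _ z] s in auto)
  then show ?thesis by simp
qed

text \<open>
  For fixed times \<open>s\<close> and \<open>r\<close> the half-plane coordinate of \<open>\<phi> s r\<close> is a holomorphic function
  with positive real part, so it grows at most linearly in a sector; the constant involves only
  the trajectory of \<open>0\<close>, which is bounded uniformly in \<open>r\<close>.
\<close>
lemma half_plane_trajectory_growth:
  assumes bd: "norm \<sigma> = 1" and s: "0 \<le> s" "s \<le> t"
  obtains K where "\<And>r z. \<lbrakk>r \<in> {s..t}; z \<in> unit_disc; norm (half_plane_map \<sigma> z) \<le> M * Re (half_plane_map \<sigma> z);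
     1 \<le> norm (half_plane_map \<sigma> z)\<rbrakk> \<Longrightarrow> norm (half_plane_map \<sigma> (\<phi> s r z)) \<le> K * norm (half_plane_map \<sigma> z)"
proof -
  have "0 \<in> unit_disc" by simp
  then obtain B where B: "B > 0" "\<And>r. r \<in> {s..t} \<Longrightarrow> norm (half_plane_map \<sigma> (\<phi> s r 0)) \<le> B"
    using dominated_increments_bounded[OF half_plane_trajectory_dominated_increments[OF bd s]] by blast
  show ?thesis
  proof (rule that)
    fix r z assume r: "r \<in> {s..t}" and z: "z \<in> unit_disc"
      and sector: "norm (half_plane_map \<sigma> z) \<le> M * Re (half_plane_map \<sigma> z)"
      and large: "1 \<le> norm (half_plane_map \<sigma> z)"
    have disc: "\<phi> s r w \<in> unit_disc" if "w \<in> unit_disc" for w using trajectory_in_disc that r s by auto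
    have "(half_plane_map \<sigma> \<circ> \<phi> s r) holomorphic_on unit_disc"
      by (rule holomorphic_on_compose_gen[OF trajectory_holomorphic half_plane_map_holomorphic[OF bd]])
         (use disc r s in auto)
    then have "norm ((half_plane_map \<sigma> \<circ> \<phi> s r) z)
        \<le> (1 + 4 * M) * norm ((half_plane_map \<sigma> \<circ> \<phi> s r) 0) * norm (half_plane_map \<sigma> z)"
      by (rule norm_le_in_sector[OF bd _ _ z sector large])
         (use Re_half_plane_map_pos[OF bd disc] in \<open>auto intro: less_imp_le\<close>)
    also have "\<dots> \<le> (1 + 4 * M) * B * norm (half_plane_map \<sigma> z)"
    proof -
      have "M > 0" using sector large Re_half_plane_map_pos[OF bd z] by (smt (verit) mult_nonpos_nonneg)
      then show ?thesis using B(2)[OF r] by (intro mult_right_mono mult_left_mono) auto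
    qed
    finally show "norm (half_plane_map \<sigma> (\<phi> s r z)) \<le> (1 + 4 * M) * B * norm (half_plane_map \<sigma> z)" by simp
  qed
qed

text \<open>
  The half-plane coordinate \<open>X\<close> of a trajectory solves \<open>X' = (2 * p / X) * X\<close>. Along
  trajectories that start far out in a sector, the coefficient tends to twice the angular slope
  and is dominated by a multiple of \<open>norm (p 0)\<close>. The point is that the trajectories stay in a
  common larger sector during the whole time interval.
\<close>
lemma half_plane_ratio_limit:
  assumes bd: "norm \<sigma> = 1" and s: "0 \<le> s" "s \<le> t"
    and Z: "\<And>n. Z n \<in> unit_disc"
    and sector: "\<And>n. norm (half_plane_map \<sigma> (Z n)) \<le> M * Re (half_plane_map \<sigma> (Z n))"
    and large: "\<And>n. max 1 M \<le> norm (half_plane_map \<sigma> (Z n))"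
    and infinity: "filterlim (\<lambda>n. norm (half_plane_map \<sigma> (Z n))) at_top sequentially"
  shows "(\<lambda>n. half_plane_map \<sigma> (\<phi> s t (Z n)) / half_plane_map \<sigma> (Z n)) \<longlonglongrightarrow>
     exp (integral {s..t} (\<lambda>r. of_real (2 * angular_slope \<sigma> (\<lambda>z. p z r))))"
proof -
  define w where "w = (\<lambda>n r. \<phi> s r (Z n))"
  define X where "X = (\<lambda>n r. half_plane_map \<sigma> (w n r))"
  define \<alpha> where "\<alpha> = (\<lambda>n r. inverse (X n r) * (2 * p (w n r) r))"
  define c where "c = (\<lambda>r. angular_slope \<sigma> (\<lambda>z. p z r))"
  define W where "W = (\<lambda>n. half_plane_map \<sigma> (Z n))"
  have W: "norm (W n) \<le> M * Re (W n)" "1 \<le> norm (W n)" "M \<le> norm (W n)" for n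
    using sector large[of n] by (auto simp: W_def)
  have ReW: "Re (W n) > 0" for n using Re_half_plane_map_pos[OF bd Z] by (simp add: W_def)
  have M: "M > 0" using W(1,2)[of 0] ReW[of 0] by (smt (verit) mult_nonpos_nonneg)
  have disc: "w n r \<in> unit_disc" if "r \<in> {s..t}" for n r using trajectory_in_disc that s Z by (auto simp: w_def)
  have Xs: "X n s = W n" for n by (simp add: X_def w_def W_def trajectory_initial[OF s(1) Z])
  have mono: "Re (W n) \<le> Re (X n r)" if "r \<in> {s..t}" for n r
    using half_plane_trajectory_Re_mono[OF bd s(1) _ Z] that by (simp add: X_def w_def W_def)
  obtain K where "\<And>r z. \<lbrakk>r \<in> {s..t}; z \<in> unit_disc; norm (half_plane_map \<sigma> z) \<le> M * Re (half_plane_map \<sigma> z);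
     1 \<le> norm (half_plane_map \<sigma> z)\<rbrakk> \<Longrightarrow> norm (half_plane_map \<sigma> (\<phi> s r z)) \<le> K * norm (half_plane_map \<sigma> z)"
    using half_plane_trajectory_growth[OF bd s] by blast
  then have growth: "norm (X n r) \<le> K * norm (W n)" if "r \<in> {s..t}" for n r
    using that Z W by (simp add: X_def w_def W_def)
  have K: "K \<ge> 0"
    using order_trans[OF norm_ge_zero growth[of s 0]] W(2)[of 0] s by (auto simp: zero_le_mult_iff)
  \<comment> \<open>The growth bound and the monotone real part confine all these trajectories to one sector,
    and the real part alone pushes them to infinity.\<close>
  have Xsector: "norm (X n r) \<le> (K * M) * Re (X n r)" if "r \<in> {s..t}" for n r
  proof -
    have "norm (X n r) \<le> K * norm (W n)" by (rule growth[OF that])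
    also have "\<dots> \<le> K * (M * Re (W n))" using K W by (intro mult_left_mono)
    also have "\<dots> \<le> K * (M * Re (X n r))" using K M mono[OF that] by (intro mult_left_mono) auto
    finally show ?thesis by (simp add: mult_ac)
  qed
  have Xlarge: "norm (W n) / M \<le> norm (X n r)" if "r \<in> {s..t}" for n r
  proof -
    have "norm (W n) / M \<le> Re (W n)" using W(1)[of n] M by (simp add: field_simps)
    also have "\<dots> \<le> norm (X n r)" using mono[OF that, of n] complex_Re_le_cmod[of "X n r"] by simp
    finally show ?thesis .
  qed
  have X1: "1 \<le> norm (X n r)" if "r \<in> {s..t}" for n r
  proof -
    have "1 \<le> norm (W n) / M" using W(3)[of n] M by (simp add: field_simps)
    then show ?thesis using Xlarge[OF that, of n] by simp
  qed
  have Xnz: "X n r \<noteq> 0" if "r \<in> {s..t}" for n r using X1[OF that, of n] by auto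
  have Xdom: "dominated_increments s t (X n)" for n
    unfolding X_def w_def by (rule half_plane_trajectory_dominated_increments[OF bd s Z])
  have "\<forall>n. \<exists>N. negligible N \<and> (\<forall>r. r \<in> {s..t} \<longrightarrow> r \<notin> N \<longrightarrow> (X n has_vector_derivative
     2 * p (w n r) r) (at r within {s..t}))"
    using half_plane_trajectory_derivative[OF bd s(1) Z] unfolding X_def w_def by metis
  then obtain N where N: "\<And>n. negligible (N n)" and
    der: "\<And>n r. \<lbrakk>r \<in> {s..t}; r \<notin> N n\<rbrakk> \<Longrightarrow> (X n has_vector_derivative 2 * p (w n r) r) (at r within {s..t})"
    by metis
  define h where "h = (\<lambda>r. 2 * (1 + 4 * (K * M)) * norm (p 0 r))"
  have "(\<lambda>n. X n t / X n s) \<longlonglongrightarrow> exp (integral {s..t} (\<lambda>r. of_real (2 * c r)))"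
  proof (rule linear_ode_limit[OF s(2) Xdom N, where \<alpha> = \<alpha> and h = h])
    show "(X n has_vector_derivative \<alpha> n r * X n r) (at r within {s..t})"
      if "r \<in> {s..t}" "r \<notin> N n" for n r
    proof -
      have "\<alpha> n r * X n r = 2 * p (w n r) r" using Xnz[OF that(1), of n] by (simp add: \<alpha>_def)
      then show ?thesis using der[OF that] by simp
    qed
    show "set_borel_measurable lebesgue {s..t} (\<alpha> n)" for n
    proof -
      have "continuous_on {s..t} (\<lambda>r. inverse (X n r) * 2)"
        using dominated_increments_continuous[OF Xdom] Xnz by (intro continuous_intros) auto
      from set_borel_measurable_continuous_mult[OF this herglotz_trajectory_measurable[OF s Z[of n]]]
      show ?thesis by (simp add: \<alpha>_def w_def mult.assoc)
    qed
    show "h integrable_on {s..t}"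
      unfolding h_def using herglotz_absolutely_integrable[of 0 s t] s
      by (intro integrable_on_mult_right) (simp add: absolutely_integrable_on_def)
    show "norm (\<alpha> n r) \<le> h r" if "r \<in> {s..t}" for n r
    proof -
      have "norm (p (w n r) r) \<le> (1 + 4 * (K * M)) * norm (p 0 r) * norm (X n r)"
        unfolding X_def
        by (rule norm_le_in_sector[OF bd herglotz_holomorphic herglotz_Re_nonneg disc[OF that]])
           (use Xsector[OF that, of n] X1[OF that, of n] that s in \<open>auto simp: X_def\<close>)
      then have "2 * norm (p (w n r) r) / norm (X n r) \<le> 2 * ((1 + 4 * (K * M)) * norm (p 0 r) * norm (X n r)) / norm (X n r)"
        by (intro divide_right_mono mult_left_mono) auto
      also have "\<dots> = h r" using Xnz[OF that, of n] by (simp add: h_def)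
      finally show ?thesis by (simp add: \<alpha>_def norm_mult norm_inverse divide_inverse mult_ac)
    qed
    show "(\<lambda>n. \<alpha> n r) \<longlonglongrightarrow> of_real (2 * c r)" if r: "r \<in> {s..t}" for r
    proof (rule LIMSEQ_I)
      fix \<epsilon> :: real assume \<epsilon>: "\<epsilon> > 0"
      have "\<exists>R. \<forall>z\<in>unit_disc. norm (half_plane_map \<sigma> z) \<le> (K * M) * Re (half_plane_map \<sigma> z) \<longrightarrow>
         R \<le> norm (half_plane_map \<sigma> z) \<longrightarrow>
         norm (p z r - c r * half_plane_map \<sigma> z) \<le> \<epsilon> / 4 * norm (half_plane_map \<sigma> z)"
        unfolding c_def
        by (rule angular_slope_asymptotic[OF bd herglotz_holomorphic herglotz_Re_nonneg]) (use r s \<epsilon> in auto)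
      then obtain R where R: "\<And>z. \<lbrakk>z \<in> unit_disc; norm (half_plane_map \<sigma> z) \<le> (K * M) * Re (half_plane_map \<sigma> z);
         R \<le> norm (half_plane_map \<sigma> z)\<rbrakk> \<Longrightarrow>
         norm (p z r - c r * half_plane_map \<sigma> z) \<le> \<epsilon> / 4 * norm (half_plane_map \<sigma> z)"
        by blast
      obtain n0 where n0: "\<And>n. n \<ge> n0 \<Longrightarrow> M * R \<le> norm (W n)"
        using infinity unfolding filterlim_at_top eventually_sequentially W_def by blast
      show "\<exists>n0. \<forall>n\<ge>n0. norm (\<alpha> n r - of_real (2 * c r)) < \<epsilon>"
      proof (intro exI[of _ n0] allI impI)
        fix n assume n: "n \<ge> n0"
        have "R \<le> norm (W n) / M" using n0[OF n] M by (simp add: field_simps)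
        also have "\<dots> \<le> norm (X n r)" by (rule Xlarge[OF r])
        finally have "norm (p (w n r) r - c r * X n r) \<le> \<epsilon> / 4 * norm (X n r)"
          using R[OF disc[OF r, of n]] Xsector[OF r, of n] by (simp add: X_def)
        then have "2 * norm (p (w n r) r - c r * X n r) / norm (X n r) \<le> 2 * (\<epsilon> / 4 * norm (X n r)) / norm (X n r)"
          by (intro divide_right_mono mult_left_mono) auto
        also have "\<dots> = \<epsilon> / 2" using Xnz[OF r, of n] by simp
        finally have "2 * norm (p (w n r) r - c r * X n r) / norm (X n r) \<le> \<epsilon> / 2" .
        moreover have "\<alpha> n r - of_real (2 * c r) = inverse (X n r) * (2 * (p (w n r) r - c r * X n r))"
          using Xnz[OF r, of n] by (simp add: \<alpha>_def algebra_simps)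
        then have "norm (\<alpha> n r - of_real (2 * c r)) = 2 * norm (p (w n r) r - c r * X n r) / norm (X n r)"
          by (simp only: norm_mult norm_inverse divide_inverse) (simp add: mult_ac)
        ultimately have "norm (\<alpha> n r - of_real (2 * c r)) \<le> \<epsilon> / 2" by simp
        then show "norm (\<alpha> n r - of_real (2 * c r)) < \<epsilon>" using \<epsilon> by simp
      qed
    qed
    show "X n s \<noteq> 0" for n using Xnz[of s] s by simp
  qed
  then show ?thesis unfolding Xs by (simp add: X_def w_def W_def c_def)
qed

lemma boundary_angular_derivative:
  assumes bd: "norm \<sigma> = 1" and s: "0 \<le> s" "s \<le> t"
  shows "has_angular_derivative (\<phi> s t)
     (exp (- integral {s..t} (\<lambda>r. of_real (2 * angular_slope \<sigma> (\<lambda>z. p z r))))) \<sigma>"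
proof -
  define E :: complex where "E = exp (integral {s..t} (\<lambda>r. of_real (2 * angular_slope \<sigma> (\<lambda>z. p z r))))"
  have E: "E \<noteq> 0" by (simp add: E_def)
  have quotient: "(\<lambda>n. (\<phi> s t (Y n) - \<sigma>) / (Y n - \<sigma>)) \<longlonglongrightarrow> inverse E"
    if Y: "\<And>n. Y n \<in> stolz_region \<sigma> M" "Y \<longlonglongrightarrow> \<sigma>" for M Y
  proof -
    define W where "W = (\<lambda>n. half_plane_map \<sigma> (Y n))"
    define F where "F = (\<lambda>n. half_plane_map \<sigma> (\<phi> s t (Y n)))"
    have disc: "Y n \<in> unit_disc" for n using Y(1) stolz_region_subset by blast
    have inf: "filterlim (\<lambda>n. norm (W n)) at_top sequentially"
      unfolding W_def by (rule half_plane_map_filterlim[OF bd disc Y(2)])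
    obtain n0 where n0: "\<And>n. n \<ge> n0 \<Longrightarrow> max 1 M \<le> norm (W n)"
      using inf unfolding filterlim_at_top eventually_sequentially by blast
    have "(\<lambda>n. half_plane_map \<sigma> (\<phi> s t (Y (n + n0))) / half_plane_map \<sigma> (Y (n + n0))) \<longlonglongrightarrow> E"
      unfolding E_def
    proof (rule half_plane_ratio_limit[OF bd s, where M = M])
      show "filterlim (\<lambda>n. norm (half_plane_map \<sigma> (Y (n + n0)))) at_top sequentially"
        by (rule half_plane_map_filterlim[OF bd disc LIMSEQ_ignore_initial_segment[OF Y(2)]])
    qed (use disc stolz_region_sector[OF bd Y(1)] n0 in \<open>auto simp: W_def\<close>)
    then have FW: "(\<lambda>n. F n / W n) \<longlonglongrightarrow> E"
      unfolding F_def W_def by (rule LIMSEQ_offset)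
    have "filterlim W at_infinity sequentially"
      using inf by (rule filterlim_norm_at_top_imp_at_infinity)
    then have W0: "(\<lambda>n. inverse (W n)) \<longlonglongrightarrow> 0"
      by (rule filterlim_compose[OF tendsto_inverse_0])
    \<comment> \<open>\<open>half_plane_map \<sigma> z + 1 = 2 \<sigma> / (\<sigma> - z)\<close> turns the ratio of half-plane coordinates into
      the inverse of the difference quotient.\<close>
    have "(\<lambda>n. (1 + inverse (W n)) / (F n / W n + inverse (W n))) \<longlonglongrightarrow> (1 + 0) / (E + 0)"
      by (intro tendsto_intros FW W0) (use E in auto)
    moreover have "\<phi> s t (Y n) - \<sigma> \<noteq> 0" "(1 + inverse (W n)) / (F n / W n + inverse (W n)) = (\<phi> s t (Y n) - \<sigma>) / (Y n - \<sigma>)" for n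
    proof -
      have ne: "\<sigma> \<noteq> Y n" "\<sigma> \<noteq> \<phi> s t (Y n)"
        using disc[of n] trajectory_in_disc[OF s disc[of n]] bd by auto
      have "W n \<noteq> 0" using Re_half_plane_map_pos[OF bd disc[of n]] by (auto simp: W_def)
      then have "(1 + inverse (W n)) / (F n / W n + inverse (W n)) = (W n + 1) / (F n + 1)"
        by (simp add: divide_simps)
      also have "\<dots> = (2 * \<sigma> / (\<sigma> - Y n)) / (2 * \<sigma> / (\<sigma> - \<phi> s t (Y n)))"
        unfolding W_def F_def half_plane_map_plus_one[OF ne(1)] half_plane_map_plus_one[OF ne(2)] ..
      also have "\<dots> = (\<phi> s t (Y n) - \<sigma>) / (Y n - \<sigma>)"
        using ne bd by (auto simp: divide_simps) (simp add: algebra_simps)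
      finally show "(1 + inverse (W n)) / (F n / W n + inverse (W n)) = (\<phi> s t (Y n) - \<sigma>) / (Y n - \<sigma>)" .
      show "\<phi> s t (Y n) - \<sigma> \<noteq> 0" using ne by simp
    qed
    ultimately show ?thesis by (simp add: inverse_eq_divide)
  qed
  have "((\<lambda>z. (\<phi> s t z - \<sigma>) / (z - \<sigma>)) \<longlongrightarrow> inverse E) (at \<sigma> within stolz_region \<sigma> M)" for M
    unfolding tendsto_at_iff_sequentially using quotient[of _ M] by (simp add: o_def)
  then have quot: "((\<lambda>z. (\<phi> s t z - \<sigma>) / (z - \<sigma>)) \<longlongrightarrow> inverse E) (at_angular \<sigma>)"
    by (simp add: tendsto_at_angular_iff)
  have "(\<phi> s t \<longlongrightarrow> \<sigma>) (at \<sigma> within stolz_region \<sigma> M)" for M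
    unfolding tendsto_at_iff_sequentially
  proof (intro allI impI)
    fix Y assume Y: "\<forall>i. Y i \<in> stolz_region \<sigma> M - {\<sigma>}" "Y \<longlonglongrightarrow> \<sigma>"
    have "(\<lambda>n. \<sigma> + (\<phi> s t (Y n) - \<sigma>) / (Y n - \<sigma>) * (Y n - \<sigma>)) \<longlonglongrightarrow> \<sigma> + inverse E * (\<sigma> - \<sigma>)"
      by (intro tendsto_intros quotient[of Y M] Y(2)) (use Y(1) in auto)
    moreover have "\<sigma> + (\<phi> s t (Y n) - \<sigma>) / (Y n - \<sigma>) * (Y n - \<sigma>) = \<phi> s t (Y n)" for n
      using Y(1) by auto
    ultimately show "(\<phi> s t \<circ> Y) \<longlonglongrightarrow> \<sigma>" by (simp add: o_def)
  qed
  then have "(\<phi> s t \<longlongrightarrow> \<sigma>) (at_angular \<sigma>)"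
    by (simp add: tendsto_at_angular_iff)
  with quot show ?thesis
    unfolding has_angular_derivative_def E_def exp_minus by simp
qed

text \<open>
  Measurability in time comes from the angular limit along one fixed sequence; the bound is the
  definition of the slope as an infimum, evaluated at the origin.
\<close>
lemma L_loc_angular_slope:
  assumes bd: "norm \<sigma> = 1"
  shows "L_loc d (\<lambda>r. 2 * angular_slope \<sigma> (\<lambda>z. p z r))"
  unfolding L_loc_def
proof (intro allI impI)
  fix T :: real assume "0 < T"
  obtain Z where Z: "\<And>n. Z n \<in> stolz_region \<sigma> 2 - {\<sigma>}" "Z \<longlonglongrightarrow> \<sigma>"
    using at_within_stolz_region_nontrivial[OF bd] unfolding trivial_limit_within islimpt_sequential by blast
  have disc: "Z n \<in> unit_disc" for n using Z(1) stolz_region_subset by blast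
  have 0: "L_on d {0..T} (p 0)" by (rule herglotz_L_on) (use \<open>0 < T\<close> in auto)
  show "L_on d {0..T} (\<lambda>r. 2 * angular_slope \<sigma> (\<lambda>z. p z r))"
  proof (rule L_on_dominated[OF 0])
    show "set_borel_measurable lebesgue {0..T} (\<lambda>r. 2 * angular_slope \<sigma> (\<lambda>z. p z r))"
      unfolding set_borel_measurable_def
    proof (rule borel_measurable_LIMSEQ_metric)
      show "(\<lambda>r. indicat_real {0..T} r *\<^sub>R (2 * (Re (p (Z n) r) / Re (half_plane_map \<sigma> (Z n))))) \<in> borel_measurable lebesgue" for n
      proof -
        have "(\<lambda>r. indicat_real {0..T} r *\<^sub>R p (Z n) r) \<in> borel_measurable lebesgue"
          using herglotz_L_on[OF disc \<open>0 < T\<close>, of n] unfolding L_on_def set_borel_measurable_def by blast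
        then have "(\<lambda>r. 2 * (Re (indicat_real {0..T} r *\<^sub>R p (Z n) r) / Re (half_plane_map \<sigma> (Z n)))) \<in> borel_measurable lebesgue"
          by measurable
        then show ?thesis by (simp add: mult_ac)
      qed
      fix r
      show "(\<lambda>n. indicat_real {0..T} r *\<^sub>R (2 * (Re (p (Z n) r) / Re (half_plane_map \<sigma> (Z n)))))
          \<longlonglongrightarrow> indicat_real {0..T} r *\<^sub>R (2 * angular_slope \<sigma> (\<lambda>z. p z r))"
      proof (cases "r \<in> {0..T}")
        case True
        have "((\<lambda>z. Re (p z r) / Re (half_plane_map \<sigma> z)) \<longlongrightarrow> angular_slope \<sigma> (\<lambda>z. p z r))
            (at \<sigma> within stolz_region \<sigma> 2)"
          using angular_slope_limit[OF bd herglotz_holomorphic herglotz_Re_nonneg, of r] True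
          unfolding tendsto_at_angular_iff by auto
        then have "(\<lambda>n. Re (p (Z n) r) / Re (half_plane_map \<sigma> (Z n))) \<longlonglongrightarrow> angular_slope \<sigma> (\<lambda>z. p z r)"
          unfolding tendsto_at_iff_sequentially using Z by (auto simp: o_def)
        then show ?thesis by (intro tendsto_intros)
      qed simp
    qed
    show "norm (2 * angular_slope \<sigma> (\<lambda>z. p z t)) \<le> 2 * norm (p 0 t)" if "t \<in> {0..T}" for t
    proof -
      have "half_plane_map \<sigma> 0 = 1" using bd by (auto simp: half_plane_map_def)
      then have "angular_slope \<sigma> (\<lambda>z. p z t) \<le> Re (p 0 t)"
        using angular_slope_le[OF bd herglotz_holomorphic herglotz_Re_nonneg, of t 0] that by simp
      moreover have "0 \<le> angular_slope \<sigma> (\<lambda>z. p z t)"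
        using angular_slope_nonneg[OF bd herglotz_holomorphic herglotz_Re_nonneg, of t] that by simp
      ultimately show ?thesis using complex_Re_le_cmod[of "p 0 t"] by simp
    qed
  qed auto
qed

lemma boundary_spectral_function:
  assumes bd: "norm \<sigma> = 1"
  shows "spectral_function d \<phi> \<sigma> (\<lambda>t. integral {0..t} (\<lambda>r. of_real (2 * angular_slope \<sigma> (\<lambda>z. p z r))))"
proof (rule spectral_function_integral)
  show "L_loc d (\<lambda>r. complex_of_real (2 * angular_slope \<sigma> (\<lambda>z. p z r)))"
    unfolding L_loc_def
  proof (intro allI impI)
    fix T :: real assume "0 < T"
    have L: "L_on d {0..T} (\<lambda>r. 2 * angular_slope \<sigma> (\<lambda>z. p z r))"
      using L_loc_angular_slope[OF bd] \<open>0 < T\<close> unfolding L_loc_def by blast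
    show "L_on d {0..T} (\<lambda>r. complex_of_real (2 * angular_slope \<sigma> (\<lambda>z. p z r)))"
    proof (rule L_on_dominated[OF L])
      have "(\<lambda>r. complex_of_real (indicat_real {0..T} r *\<^sub>R (2 * angular_slope \<sigma> (\<lambda>z. p z r)))) \<in> borel_measurable lebesgue"
        using L[unfolded L_on_def set_borel_measurable_def, THEN conjunct1] by measurable
      then show "set_borel_measurable lebesgue {0..T} (\<lambda>r. complex_of_real (2 * angular_slope \<sigma> (\<lambda>z. p z r)))"
        unfolding set_borel_measurable_def
        by (rule measurable_cong[THEN iffD1, rotated]) (auto simp: indicator_def)
      show "norm (complex_of_real (2 * angular_slope \<sigma> (\<lambda>z. p z t))) \<le> 1 * norm (2 * angular_slope \<sigma> (\<lambda>z. p z t))" for t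
        unfolding norm_of_real by simp
    qed auto
  qed
  show "0 \<le> Re (complex_of_real (2 * angular_slope \<sigma> (\<lambda>z. p z t)))" if "0 \<le> t" for t
    using angular_slope_nonneg[OF bd herglotz_holomorphic herglotz_Re_nonneg, of t] that by simp
  show "has_derivative_at_fixed_point (\<phi> s t)
      (exp (- integral {s..t} (\<lambda>r. of_real (2 * angular_slope \<sigma> (\<lambda>z. p z r))))) \<sigma>"
    if "0 \<le> s" "s \<le> t" for s t
    using boundary_angular_derivative[OF bd that] bd unfolding has_derivative_at_fixed_point_def by auto
qed

end

section \<open>The spectral function\<close>

theorem theorem7p1:
  fixes d :: ennreal
    and \<phi> :: "real \<Rightarrow> real \<Rightarrow> complex \<Rightarrow> complex"
    and p :: "complex \<Rightarrow> real \<Rightarrow> complex"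
    and \<tau> :: "real \<Rightarrow> complex"
    and \<tau>\<^sub>0 :: complex
  assumes "1 \<le> d"
    and "evolution_family d \<phi>"
    and "berkson_porta_data d \<phi> p \<tau>"
    and "\<forall>t\<ge>0. \<tau> t = \<tau>\<^sub>0"
  shows "\<exists>l :: real \<Rightarrow> complex.
    spectral_function d \<phi> \<tau>\<^sub>0 l \<and>
    (\<forall>m. spectral_function d \<phi> \<tau>\<^sub>0 m \<longrightarrow> (\<forall>t\<ge>0. m t = l t)) \<and>
    (\<tau>\<^sub>0 \<in> unit_disc \<longrightarrow>
       (\<forall>t\<ge>0. l t = (1 - (norm \<tau>\<^sub>0)\<^sup>2) *\<^sub>R (LINT \<xi>:{0..t}|lebesgue. p \<tau>\<^sub>0 \<xi>))) \<and>
    (\<tau>\<^sub>0 \<in> sphere 0 1 \<longrightarrow>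
       (\<exists>c :: real \<Rightarrow> real.
          (\<forall>\<xi>\<ge>0. ((\<lambda>z. 2 * (norm (\<tau>\<^sub>0 - z))\<^sup>2 * Re (p z \<xi>) / (1 - (norm z)\<^sup>2)) \<longlongrightarrow> c \<xi>)
                    (at_angular \<tau>\<^sub>0)) \<and>
          (\<forall>t\<ge>0. set_integrable lebesgue {0..t} c \<and>
                 l t = of_real (LINT \<xi>:{0..t}|lebesgue. c \<xi>))))"
proof -
  have in_cball: "\<tau>\<^sub>0 \<in> cball 0 1"
    using assms(3,4) unfolding berkson_porta_data_def by (metis order_refl)
  interpret evolution_with_constant_tau d \<phi> p \<tau>\<^sub>0
  proof
    show "herglotz_function d p" using assms(3) unfolding berkson_porta_data_def by blast
    fix z s assume zs: "z \<in> unit_disc" "(0::real) \<le> s"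
    then have "AE t in lebesgue. s \<le> t \<longrightarrow>
        ((\<lambda>r. \<phi> s r z) has_vector_derivative berkson_porta_field p \<tau> (\<phi> s t z) t) (at t within {s..})"
      using assms(3) unfolding berkson_porta_data_def by blast
    then show "AE t in lebesgue. s \<le> t \<longrightarrow> ((\<lambda>r. \<phi> s r z) has_vector_derivative
           (\<phi> s t z - \<tau>\<^sub>0) * (cnj \<tau>\<^sub>0 * \<phi> s t z - 1) * p (\<phi> s t z) t) (at t within {s..})"
      by eventually_elim (use assms(4) zs in \<open>auto simp: berkson_porta_field_def\<close>)
  qed (use assms(1,2) in_cball in auto)
  show ?thesis
  proof (cases "\<tau>\<^sub>0 \<in> unit_disc")
    case True
    define l where "l = (\<lambda>t. integral {0..t} (\<lambda>r. of_real (1 - (norm \<tau>\<^sub>0)\<^sup>2) * p \<tau>\<^sub>0 r))"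
    have l: "spectral_function d \<phi> \<tau>\<^sub>0 l"
      unfolding l_def by (rule interior_spectral_function[OF True])
    show ?thesis
    proof (intro exI[of _ l] conjI allI impI l)
      show "m t = l t" if "spectral_function d \<phi> \<tau>\<^sub>0 m" "0 \<le> t" for m t
        by (rule spectral_function_unique[OF in_cball l that])
      show "l t = (1 - (norm \<tau>\<^sub>0)\<^sup>2) *\<^sub>R (LINT \<xi>:{0..t}|lebesgue. p \<tau>\<^sub>0 \<xi>)" for t
        unfolding set_lebesgue_integral_eq_integral(2)[OF herglotz_absolutely_integrable[OF True order_refl]] l_def
          integral_mult_right scaleR_conv_of_real ..
    qed (use True in auto)
  next
    case False
    then have bd: "norm \<tau>\<^sub>0 = 1" using in_cball by simp
    define c where "c = (\<lambda>r. 2 * angular_slope \<tau>\<^sub>0 (\<lambda>z. p z r))"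
    define l where "l = (\<lambda>t. integral {0..t} (\<lambda>r. complex_of_real (c r)))"
    have l: "spectral_function d \<phi> \<tau>\<^sub>0 l"
      unfolding l_def c_def by (rule boundary_spectral_function[OF bd])
    have lim: "((\<lambda>z. 2 * (norm (\<tau>\<^sub>0 - z))\<^sup>2 * Re (p z \<xi>) / (1 - (norm z)\<^sup>2)) \<longlongrightarrow> c \<xi>) (at_angular \<tau>\<^sub>0)"
      if "0 \<le> \<xi>" for \<xi>
    proof -
      have "((\<lambda>z. 2 * (Re (p z \<xi>) / Re (half_plane_map \<tau>\<^sub>0 z))) \<longlongrightarrow> c \<xi>) (at_angular \<tau>\<^sub>0)"
        unfolding c_def
        by (intro tendsto_intros angular_slope_limit[OF bd] herglotz_holomorphic herglotz_Re_nonneg that)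
      then show ?thesis by (simp add: Re_half_plane_map[OF bd] mult_ac)
    qed
    have c: "set_integrable lebesgue {0..t} c" for t
    proof -
      have "c absolutely_integrable_on {0..\<bar>t\<bar> + 1}"
        using L_loc_angular_slope[OF bd] unfolding L_loc_def c_def
        by (intro L_on_imp_absolutely_integrable[OF _ assms(1)]) auto
      then show ?thesis by (rule absolutely_integrable_on_subinterval) auto
    qed
    have l_eq: "l t = of_real (LINT \<xi>:{0..t}|lebesgue. c \<xi>)" for t
    proof -
      have "((\<lambda>r. complex_of_real (c r)) has_integral of_real (LINT \<xi>:{0..t}|lebesgue. c \<xi>)) {0..t}"
        using has_integral_linear[OF has_integral_set_lebesgue[OF c] bounded_linear_of_real] by (simp add: o_def)
      then show ?thesis unfolding l_def by (rule integral_unique)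
    qed
    show ?thesis
    proof (intro exI[of _ l] conjI allI impI l exI[of _ c])
      show "m t = l t" if "spectral_function d \<phi> \<tau>\<^sub>0 m" "0 \<le> t" for m t
        by (rule spectral_function_unique[OF in_cball l that])
    qed (use False in \<open>simp_all add: lim c l_eq\<close>)
  qed
qed

end
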